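(* Let $n\ge1$ and let $1\le l\le j\le 2n$ with $j-l<n$. Then the specification $R_{l,j}(\mathbf{X},\mathbf{Y},\mathbf{I})$, with system inputs $\mathbf{I}$ and system outputs $(\mathbf{X},\mathbf{Y})$, is representable by a circuit of size polynomial in $n$ that is in SAUNF with respect to $\mathrm{set}(\mathbf{X})\cup\mathrm{set}(\mathbf{Y})$ and some sequence of sets of leaves.
   Context: $\mathbf{X},\mathbf{Y}$ are sequences of $n$ Boolean output variables and $\mathbf{I}$ a sequence of $2n$ Boolean input variables, each read as an unsigned integer in binary with bit $1$ the least significant. $R_{l,j}(\mathbf{X},\mathbf{Y},\mathbf{I})$ is the Boolean relation that is true iff bits $l$ through $j$ (inclusive) of the $2n$-bit unsigned product $\mathbf{X}\times\mathbf{Y}$ equal bits $l$ through $j$ of $\mathbf{I}$. A circuit is an NNF circuit: a rooted DAG whose nodes are all descendants of the root, internal nodes labeled $\wedge$ or $\vee$ with two children, leaves labeled by literals or constants $\top,\bot$ (labels may repeat); size is the number of nodes, $\varphi_G$ the represented formula, $[\![\varphi_G]\!]$ its function. An $\ell$-leaf is a leaf labeled $\ell$; a set of leaves is literal-consistent if all carry the same literal. $G|_{L:b}$ relabels each leaf in $L$ by $b$; $G|_{\ell_1=b_1,\dots}$ relabels all $\ell_j$-leaves by $b_j$ ($\ell$, $\neg\ell$ distinct). $[\![\varphi]\!]_\sigma$ denotes substitution of an assignment $\sigma$. Let $\mathbf{Z}$ denote the output variables. For a literal $\ell$ labeling a leaf of $G$ with variable $v_\ell$ and fresh $w,w'$: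 $\ell$ is $\wedge$-realizable in $G$ iff some assignment $\sigma$ of all variables other than $v_\ell$ gives $[\![G|_{\ell=w,\neg\ell=w'}]\!]_\sigma=[\![w\wedge w']\!]$, else $\wedge$-unrealizable. A literal-consistent set $S$ of $\ell$-leaves, with $S'$ all $\ell$-leaves, is $\wedge$-(un)realizable in $G$ iff $\ell$ is $\wedge$-(un)realizable in $G|_{S'\setminus S:\bot}$. $G$ is in SAUNF w.r.t. the output set $\mathbf{Z}$ and a non-empty sequence $S=(S_1,\dots,S_k)$ of leaf sets iff: the $S_j$ are pairwise disjoint; each $S_j$ is literal-consistent with a literal over $\mathbf{Z}$; $S_1$ is $\wedge$-unrealizable in $G$; for $2\le j\le k$, $S_j$ is $\wedge$-unrealizable in $G|_{S_1:\top,\dots,S_{j-1}:\top}$; and $[\![\varphi_{G|_{S_1:\top,\dots,S_k:\top}}]\!]$ does not depend on the variables of $\mathbf{Z}$. *)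

theory Defs
  imports Main "HOL-Computational_Algebra.Polynomial"
begin

section \<open>NNF circuits\<close>

datatype 'v lit = Pos (var_of: 'v) | Neg (var_of: 'v)

fun compl :: "'v lit \<Rightarrow> 'v lit" where
  "compl (Pos v) = Neg v"
| "compl (Neg v) = Pos v"

datatype 'v leaf = Lit "'v lit" | Cst bool

datatype ('a, 'v) gate = Leaf "'v leaf" | And 'a 'a | Or 'a 'a

record ('a, 'v) circuit =
  nodes :: "'a set"
  root :: 'a
  gate :: "'a \<Rightarrow> ('a, 'v) gate"

fun children :: "('a, 'v) gate \<Rightarrow> 'a set" where
  "children (Leaf a) = {}"
| "children (And x y) = {x, y}"
| "children (Or x y) = {x, y}"

definition edges :: "('a, 'v) circuit \<Rightarrow> ('a \<times> 'a) set" where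
  "edges G = {(x, y). x \<in> nodes G \<and> y \<in> children (gate G x)}"

text \<open>The graph is simple, so the two children of an internal node are distinct.\<close>

definition nnf_circuit :: "('a, 'v) circuit \<Rightarrow> bool" where
  "nnf_circuit G \<longleftrightarrow>
     finite (nodes G) \<and> root G \<in> nodes G \<and> edges G \<subseteq> nodes G \<times> nodes G \<and>
     acyclic (edges G) \<and> (\<forall>x \<in> nodes G. (root G, x) \<in> (edges G)\<^sup>*) \<and>
     (\<forall>x \<in> nodes G. \<forall>y z. gate G x = And y z \<or> gate G x = Or y z \<longrightarrow> y \<noteq> z)"

definition circuit_size :: "('a, 'v) circuit \<Rightarrow> nat" where
  "circuit_size G = card (nodes G)"

fun lit_true :: "('v \<Rightarrow> bool) \<Rightarrow> 'v lit \<Rightarrow> bool" where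
  "lit_true \<sigma> (Pos v) = \<sigma> v"
| "lit_true \<sigma> (Neg v) = (\<not> \<sigma> v)"

fun leaf_true :: "('v \<Rightarrow> bool) \<Rightarrow> 'v leaf \<Rightarrow> bool" where
  "leaf_true \<sigma> (Lit m) = lit_true \<sigma> m"
| "leaf_true \<sigma> (Cst b) = b"

text \<open>
  Truth of the formula rooted at a node. The least fixed point agrees with recursive evaluation
  by the equations \<open>true_at_iff\<close> below, which have a unique solution on an acyclic circuit.
\<close>

inductive true_at :: "('a, 'v) circuit \<Rightarrow> ('v \<Rightarrow> bool) \<Rightarrow> 'a \<Rightarrow> bool"
  for G :: "('a, 'v) circuit" and \<sigma> :: "'v \<Rightarrow> bool" where
  "gate G x = Leaf a \<Longrightarrow> leaf_true \<sigma> a \<Longrightarrow> true_at G \<sigma> x"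
| "gate G x = And y z \<Longrightarrow> true_at G \<sigma> y \<Longrightarrow> true_at G \<sigma> z \<Longrightarrow> true_at G \<sigma> x"
| "gate G x = Or y z \<Longrightarrow> true_at G \<sigma> y \<Longrightarrow> true_at G \<sigma> x"
| "gate G x = Or y z \<Longrightarrow> true_at G \<sigma> z \<Longrightarrow> true_at G \<sigma> x"

lemma true_at_iff:
  "gate G x = Leaf a \<Longrightarrow> true_at G \<sigma> x \<longleftrightarrow> leaf_true \<sigma> a"
  "gate G x = And y z \<Longrightarrow> true_at G \<sigma> x \<longleftrightarrow> true_at G \<sigma> y \<and> true_at G \<sigma> z"
  "gate G x = Or y z \<Longrightarrow> true_at G \<sigma> x \<longleftrightarrow> true_at G \<sigma> y \<or> true_at G \<sigma> z"
  by (subst true_at.simps, simp)+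

definition circuit_fun :: "('a, 'v) circuit \<Rightarrow> ('v \<Rightarrow> bool) \<Rightarrow> bool" where
  "circuit_fun G \<sigma> = true_at G \<sigma> (root G)"

definition lit_leaves :: "('a, 'v) circuit \<Rightarrow> 'v lit \<Rightarrow> 'a set" where
  "lit_leaves G m = {x \<in> nodes G. gate G x = Leaf (Lit m)}"

definition circuit_vars :: "('a, 'v) circuit \<Rightarrow> 'v set" where
  "circuit_vars G = {v. lit_leaves G (Pos v) \<noteq> {} \<or> lit_leaves G (Neg v) \<noteq> {}}"

fun relabel_gate :: "('v leaf \<Rightarrow> 'w leaf) \<Rightarrow> ('a, 'v) gate \<Rightarrow> ('a, 'w) gate" where
  "relabel_gate f (Leaf a) = Leaf (f a)"
| "relabel_gate f (And y z) = And y z"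
| "relabel_gate f (Or y z) = Or y z"

definition relabel :: "('a \<Rightarrow> 'v leaf \<Rightarrow> 'w leaf) \<Rightarrow> ('a, 'v) circuit \<Rightarrow> ('a, 'w) circuit" where
  "relabel f G = \<lparr>nodes = nodes G, root = root G, gate = (\<lambda>x. relabel_gate (f x) (gate G x))\<rparr>"

text \<open>\<open>set_leaves L b G\<close> is $G|_{L:b}$.\<close>

definition set_leaves :: "'a set \<Rightarrow> bool \<Rightarrow> ('a, 'v) circuit \<Rightarrow> ('a, 'v) circuit" where
  "set_leaves L b = relabel (\<lambda>x a. if x \<in> L then Cst b else a)"


section \<open>Conjunctive realizability\<close>

text \<open>The original variables together with the fresh variables $w$ and $w'$.\<close>

datatype 'v fresh = Old 'v | W | W'

text \<open>\<open>split_lit m G\<close> is $G|_{m = w, \neg m = w'}$.\<close>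

definition split_lit :: "'v lit \<Rightarrow> ('a, 'v) circuit \<Rightarrow> ('a, 'v fresh) circuit" where
  "split_lit m = relabel (\<lambda>_ a.
     if a = Lit m then Lit (Pos W)
     else if a = Lit (compl m) then Lit (Pos W')
     else map_leaf Old a)"

text \<open>
  The value of \<open>\<sigma>\<close> at the variable of \<open>m\<close> is not used; \<open>\<tau>\<close> ranges over all extensions of
  the rest of \<open>\<sigma>\<close> to the remaining variables.
\<close>

definition and_realizable :: "('a, 'v) circuit \<Rightarrow> 'v lit \<Rightarrow> bool" where
  "and_realizable G m \<longleftrightarrow>
     (\<exists>\<sigma>. \<forall>\<tau>. (\<forall>v. v \<noteq> var_of m \<longrightarrow> \<tau> (Old v) = \<sigma> v) \<longrightarrow>
        circuit_fun (split_lit m G) \<tau> = (\<tau> W \<and> \<tau> W'))"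

text \<open>
  Used only for non-empty literal-consistent sets of leaves, for which \<open>m\<close> is determined by \<open>S\<close>.
\<close>

definition and_realizable_set :: "('a, 'v) circuit \<Rightarrow> 'a set \<Rightarrow> bool" where
  "and_realizable_set G S \<longleftrightarrow>
     (\<exists>m. S \<subseteq> lit_leaves G m \<and> and_realizable (set_leaves (lit_leaves G m - S) False G) m)"

definition independent_of :: "(('v \<Rightarrow> bool) \<Rightarrow> bool) \<Rightarrow> 'v set \<Rightarrow> bool" where
  "independent_of f Z \<longleftrightarrow> (\<forall>\<sigma> \<tau>. (\<forall>v. v \<notin> Z \<longrightarrow> \<sigma> v = \<tau> v) \<longrightarrow> f \<sigma> = f \<tau>)"

text \<open>
  List positions start at \<open>0\<close>, so \<open>take i S\<close> consists of the sets preceding \<open>S ! i\<close>; the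
  first set is considered in \<open>G\<close> itself because nothing has been relabelled.
\<close>

definition saunf :: "('a, 'v) circuit \<Rightarrow> 'v set \<Rightarrow> 'a set list \<Rightarrow> bool" where
  "saunf G Z S \<longleftrightarrow>
     nnf_circuit G \<and> S \<noteq> [] \<and>
     (\<forall>i < length S. \<forall>k < length S. i \<noteq> k \<longrightarrow> S ! i \<inter> S ! k = {}) \<and>
     (\<forall>L \<in> set S. L \<noteq> {} \<and> (\<exists>m. var_of m \<in> Z \<and> L \<subseteq> lit_leaves G m)) \<and>
     (\<forall>i < length S. \<not> and_realizable_set (set_leaves (\<Union> (set (take i S))) True G) (S ! i)) \<and>
     independent_of (circuit_fun (set_leaves (\<Union> (set S)) True G)) Z"

lemma set_leaves_empty: "set_leaves {} b (G :: ('a, 'v) circuit) = G"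
proof -
  have "relabel_gate (\<lambda>a. a) g = g" for g :: "('a, 'v) gate"
    by (cases g) auto
  then show ?thesis
    by (simp add: set_leaves_def relabel_def)
qed


section \<open>Bits of a product\<close>

datatype var = Xv nat | Yv nat | Iv nat

text \<open>
  Bit positions of variables start at \<open>1\<close> (least significant), those of \<^const>\<open>bit\<close> at \<open>0\<close>.
\<close>

definition num_of :: "(nat \<Rightarrow> var) \<Rightarrow> nat \<Rightarrow> (var \<Rightarrow> bool) \<Rightarrow> nat" where
  "num_of V m \<sigma> = horner_sum of_bool 2 (map (\<lambda>i. \<sigma> (V i)) [1..<Suc m])"

definition mult_rel :: "nat \<Rightarrow> nat \<Rightarrow> nat \<Rightarrow> (var \<Rightarrow> bool) \<Rightarrow> bool" where
  "mult_rel n l j \<sigma> \<longleftrightarrow>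
     (\<forall>k \<in> {l..j}. bit (num_of Xv n \<sigma> * num_of Yv n \<sigma>) (k - 1) = bit (num_of Iv (2 * n) \<sigma>) (k - 1))"

definition out_vars :: "nat \<Rightarrow> var set" where
  "out_vars n = Xv ` {1..n} \<union> Yv ` {1..n}"

definition in_vars :: "nat \<Rightarrow> var set" where
  "in_vars n = Iv ` {1..2 * n}"

end

theory Submission
  imports Defs "HOL-Library.Countable"
begin

text \<open>
  Let $\varphi$ be a circuit for the relation, by schoolbook multiplication. To it we add, as
  further disjuncts, terms $D_t = \bigwedge_i ((z_i \wedge A_{t,i}) \vee (\neg z_i \wedge B_{t,i}))$ over the
  outputs $z_i$, whose guards $A_{t,i}, B_{t,i}$ are leaves over the inputs, such that $D_t$ implies
  $\varphi$ and $\varphi$ implies $\bigvee_t \bigwedge_i (A_{t,i} \vee B_{t,i})$. The sequence consists of the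
  output leaves of the terms, one at a time in any order. Setting all of them to true leaves a
  circuit equivalent to $\bigvee_t \bigwedge_i (A_{t,i} \vee B_{t,i})$, which is free of outputs.

  For the terms: if $l \le n$ or $j < 2n$, take $X = 2^a$ with $a = \min(l, n) - 1$, so that
  $Y = \lfloor I / 2^a \rfloor \bmod 2^n$ is a solution. Otherwise $j = 2n$ and $l > n$; take
  $X = 2^n - 1$, for which $\lfloor X Y / 2^n \rfloor = Y - 1$. Incrementing the upper half of $I$ is
  expressed by one term for each position $t$ of its lowest zero, where positions below $l$ impose
  no guard. If $l = n + 1$ and the upper half
  of $I$ is all ones, there is no solution, and no term has satisfiable guards.
\<close>


section \<open>Straight-line programs\<close>

fun gate_value :: "('a \<Rightarrow> bool) \<Rightarrow> ('v \<Rightarrow> bool) \<Rightarrow> ('a, 'v) gate \<Rightarrow> bool" where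
  "gate_value f \<sigma> (Leaf a) = leaf_true \<sigma> a"
| "gate_value f \<sigma> (And y z) = (f y \<and> f z)"
| "gate_value f \<sigma> (Or y z) = (f y \<or> f z)"

lemma true_at_gate_value: "true_at G \<sigma> x = gate_value (true_at G \<sigma>) \<sigma> (gate G x)"
  by (cases "gate G x") (simp_all add: true_at_iff)

definition proper_gate :: "('a, 'v) gate \<Rightarrow> bool" where
  "proper_gate h \<longleftrightarrow> (\<forall>y z. h = And y z \<or> h = Or y z \<longrightarrow> y \<noteq> z)"

lemma proper_gate_simps [simp]:
  "proper_gate (Leaf a)"
  "proper_gate (And y z) \<longleftrightarrow> y \<noteq> z"
  "proper_gate (Or y z) \<longleftrightarrow> y \<noteq> z"
  by (auto simp: proper_gate_def)

definition gate_over :: "'v set \<Rightarrow> ('a, 'v) gate \<Rightarrow> bool" where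
  "gate_over V h \<longleftrightarrow> (\<forall>u. h = Leaf (Lit u) \<longrightarrow> var_of u \<in> V)"

lemma gate_over_simps [simp]:
  "gate_over V (Leaf (Lit u)) \<longleftrightarrow> var_of u \<in> V"
  "gate_over V (Leaf (Cst b))"
  "gate_over V (And y z)"
  "gate_over V (Or y z)"
  by (auto simp: gate_over_def)

text \<open>Children have smaller indices, so the graph is acyclic by construction and the gate
  equations determine \<open>val\<close> below \<open>M\<close>.\<close>

definition program ::
  "'v set \<Rightarrow> nat \<Rightarrow> (nat \<Rightarrow> (nat, 'v) gate) \<Rightarrow> (nat \<Rightarrow> ('v \<Rightarrow> bool) \<Rightarrow> bool) \<Rightarrow> bool" where
  "program V M g val \<longleftrightarrow>
     (\<forall>k<M. children (g k) \<subseteq> {..<k} \<and> proper_gate (g k) \<and> gate_over V (g k) \<and>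
        (\<forall>\<sigma>. val k \<sigma> = gate_value (\<lambda>i. val i \<sigma>) \<sigma> (g k)))"

lemma program_le: "program V M g val \<Longrightarrow> M' \<le> M \<Longrightarrow> program V M' g val"
  by (auto simp: program_def)

lemma gate_value_cong:
  "(\<And>i. i \<in> children h \<Longrightarrow> f i = f' i) \<Longrightarrow> gate_value f \<sigma> h = gate_value f' \<sigma> h"
  by (cases h) auto

lemma program_snoc:
  assumes "program V M g val" "children h \<subseteq> {..<M}" "proper_gate h" "gate_over V h"
  shows "program V (Suc M) (g(M := h)) (val(M := \<lambda>\<sigma>. gate_value (\<lambda>i. val i \<sigma>) \<sigma> h))"
    (is "program V _ ?g ?val")
  unfolding program_def
proof (intro allI impI)
  fix k assume k: "k < Suc M"
  let ?h = "?g k"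
  have c: "children ?h \<subseteq> {..<k}" "proper_gate ?h" "gate_over V ?h"
    using assms k by (auto simp: program_def less_Suc_eq)
  moreover have "?val k \<sigma> = gate_value (\<lambda>i. ?val i \<sigma>) \<sigma> ?h" for \<sigma>
  proof -
    have "gate_value (\<lambda>i. ?val i \<sigma>) \<sigma> ?h = gate_value (\<lambda>i. val i \<sigma>) \<sigma> ?h"
      using c k by (intro gate_value_cong) auto
    then show ?thesis
      using assms k by (auto simp: program_def less_Suc_eq)
  qed
  ultimately show "children ?h \<subseteq> {..<k} \<and> proper_gate ?h \<and> gate_over V ?h \<and>
      (\<forall>\<sigma>. ?val k \<sigma> = gate_value (\<lambda>i. ?val i \<sigma>) \<sigma> ?h)"
    by blast
qed

text \<open>A whole set of functions is tracked, so that later gates can share earlier results;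
  \<open>N\<close> bounds the number of gates.\<close>

definition computed :: "'v set \<Rightarrow> nat \<Rightarrow> (('v \<Rightarrow> bool) \<Rightarrow> bool) set \<Rightarrow> bool" where
  "computed V N F \<longleftrightarrow> (\<exists>M g val. M \<le> N \<and> program V M g val \<and> F \<subseteq> val ` {..<M})"

lemma computed_snoc:
  assumes "program V M g val" "M \<le> N" "F \<subseteq> val ` {..<M}"
    "children h \<subseteq> {..<M}" "proper_gate h" "gate_over V h"
    "\<And>\<sigma>. f \<sigma> = gate_value (\<lambda>i. val i \<sigma>) \<sigma> h"
  shows "computed V (Suc N) (insert f F)"
  unfolding computed_def
proof (intro exI conjI)
  have "f = (\<lambda>\<sigma>. gate_value (\<lambda>i. val i \<sigma>) \<sigma> h)"
    using assms(7) by blast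
  then show "program V (Suc M) (g(M := h)) (val(M := f))"
    using program_snoc[OF assms(1,4-6)] by simp
  have "val ` {..<M} = (val(M := f)) ` {..<M}"
    by (intro image_cong) auto
  then show "insert f F \<subseteq> (val(M := f)) ` {..<Suc M}"
    using assms(3) by (force simp: lessThan_Suc)
qed (use assms(2) in simp)

lemma computed_mono: "computed V N F \<Longrightarrow> N \<le> N' \<Longrightarrow> F' \<subseteq> F \<Longrightarrow> computed V N' F'"
  unfolding computed_def by (meson order_trans)

lemma computed_leaf:
  assumes "computed V N F" "\<And>u. a = Lit u \<Longrightarrow> var_of u \<in> V" "\<And>\<sigma>. f \<sigma> = leaf_true \<sigma> a"
  shows "computed V (Suc N) (insert f F)"
proof -
  obtain M g val where "M \<le> N" "program V M g val" "F \<subseteq> val ` {..<M}"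
    using assms(1) unfolding computed_def by blast
  with assms(2,3) show ?thesis
    by (intro computed_snoc[where h = "Leaf a"]) (auto simp: gate_over_def)
qed

lemma computed_binary:
  assumes "computed V N F" "f \<in> F" "f' \<in> F"
  shows "computed V (Suc N) (insert (\<lambda>\<sigma>. f \<sigma> \<and> f' \<sigma>) F)"
    and "computed V (Suc N) (insert (\<lambda>\<sigma>. f \<sigma> \<or> f' \<sigma>) F)"
proof -
  obtain M g val where *: "M \<le> N" "program V M g val" "F \<subseteq> val ` {..<M}"
    using assms(1) unfolding computed_def by blast
  obtain i i' where i: "i < M" "f = val i" "i' < M" "f' = val i'"
    using * assms(2,3) by blast
  have "computed V (Suc N) (insert (\<lambda>\<sigma>. f \<sigma> \<and> f' \<sigma>) F) \<and>
        computed V (Suc N) (insert (\<lambda>\<sigma>. f \<sigma> \<or> f' \<sigma>) F)"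
  proof (cases "i = i'")
    \<comment> \<open>\<open>And i i\<close> would violate \<open>proper_gate\<close>, but here
      conjunction and disjunction are both \<open>f\<close>, which is already in
      \<open>F\<close>.\<close>
    case True
    then show ?thesis
      using assms i by (simp add: insert_absorb) (rule computed_mono, auto)
  next
    case False
    have "computed V (Suc N) (insert (\<lambda>\<sigma>. f \<sigma> \<and> f' \<sigma>) F)"
      using * i False by (intro computed_snoc[where h = "And i i'"]) auto
    moreover have "computed V (Suc N) (insert (\<lambda>\<sigma>. f \<sigma> \<or> f' \<sigma>) F)"
      using * i False by (intro computed_snoc[where h = "Or i i'"]) auto
    ultimately show ?thesis ..
  qed
  then show "computed V (Suc N) (insert (\<lambda>\<sigma>. f \<sigma> \<and> f' \<sigma>) F)"
    and "computed V (Suc N) (insert (\<lambda>\<sigma>. f \<sigma> \<or> f' \<sigma>) F)"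
    by auto
qed

text \<open>
  Negations occur only at leaves, so every function is computed together with its complement.
\<close>

definition dual_rail :: "'v set \<Rightarrow> nat \<Rightarrow> (('v \<Rightarrow> bool) \<Rightarrow> bool) set \<Rightarrow> bool" where
  "dual_rail V N F \<longleftrightarrow> computed V N (F \<union> (\<lambda>f \<sigma>. \<not> f \<sigma>) ` F)"

lemma dual_rail_empty: "dual_rail V 0 {}"
  by (auto simp: dual_rail_def computed_def program_def)

lemma dual_rail_mono: "dual_rail V N F \<Longrightarrow> N \<le> N' \<Longrightarrow> F' \<subseteq> F \<Longrightarrow> dual_rail V N' F'"
  unfolding dual_rail_def by (erule computed_mono) auto

lemma dual_rail_const:
  assumes "dual_rail V N F"
  shows "dual_rail V (N + 2) (insert (\<lambda>_. b) F)"
proof -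
  have "computed V (Suc (Suc N)) (insert (\<lambda>_. b) (insert (\<lambda>_. \<not> b) (F \<union> (\<lambda>f \<sigma>. \<not> f \<sigma>) ` F)))"
    using assms unfolding dual_rail_def
    by (intro computed_leaf[where a = "Cst b"] computed_leaf[where a = "Cst (\<not> b)"]) auto
  then show ?thesis
    unfolding dual_rail_def by (rule computed_mono) auto
qed

lemma dual_rail_var:
  assumes "dual_rail V N F" "v \<in> V"
  shows "dual_rail V (N + 2) (insert (\<lambda>\<sigma>. \<sigma> v) F)"
proof -
  have "computed V (Suc (Suc N))
      (insert (\<lambda>\<sigma>. \<sigma> v) (insert (\<lambda>\<sigma>. \<not> \<sigma> v) (F \<union> (\<lambda>f \<sigma>. \<not> f \<sigma>) ` F)))"
    using assms unfolding dual_rail_def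
    by (intro computed_leaf[where a = "Lit (Pos v)"] computed_leaf[where a = "Lit (Neg v)"]) auto
  then show ?thesis
    unfolding dual_rail_def by (rule computed_mono) auto
qed

text \<open>No gate is spent: both rails are present, and negation merely swaps them.\<close>

lemma dual_rail_not:
  assumes "dual_rail V N F" "f \<in> F"
  shows "dual_rail V N (insert (\<lambda>\<sigma>. \<not> f \<sigma>) F)"
  using assms unfolding dual_rail_def by (elim computed_mono) auto

lemma dual_rail_conj:
  assumes "dual_rail V N F" "f \<in> F" "f' \<in> F"
  shows "dual_rail V (N + 2) (insert (\<lambda>\<sigma>. f \<sigma> \<and> f' \<sigma>) F)"
proof -
  have "computed V (Suc (Suc N)) (insert (\<lambda>\<sigma>. f \<sigma> \<and> f' \<sigma>)
      (insert (\<lambda>\<sigma>. \<not> f \<sigma> \<or> \<not> f' \<sigma>) (F \<union> (\<lambda>f \<sigma>. \<not> f \<sigma>) ` F)))"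
    using assms unfolding dual_rail_def by (intro computed_binary) auto
  then show ?thesis
    unfolding dual_rail_def by (rule computed_mono) auto
qed

lemma dual_rail_disj:
  assumes "dual_rail V N F" "f \<in> F" "f' \<in> F"
  shows "dual_rail V (N + 2) (insert (\<lambda>\<sigma>. f \<sigma> \<or> f' \<sigma>) F)"
proof -
  have "computed V (Suc (Suc N)) (insert (\<lambda>\<sigma>. f \<sigma> \<or> f' \<sigma>)
      (insert (\<lambda>\<sigma>. \<not> f \<sigma> \<and> \<not> f' \<sigma>) (F \<union> (\<lambda>f \<sigma>. \<not> f \<sigma>) ` F)))"
    using assms unfolding dual_rail_def by (intro computed_binary) auto
  then show ?thesis
    unfolding dual_rail_def by (rule computed_mono) auto
qed

lemma dual_rail_xor:
  assumes "dual_rail V N F" "f \<in> F" "f' \<in> F"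
  shows "dual_rail V (N + 6) (insert (\<lambda>\<sigma>. f \<sigma> \<noteq> f' \<sigma>) F)"
proof -
  let ?F = "insert (\<lambda>\<sigma>. \<not> f' \<sigma>) (insert (\<lambda>\<sigma>. \<not> f \<sigma>) F)"
  let ?a = "\<lambda>\<sigma>. f \<sigma> \<and> \<not> f' \<sigma>" and ?b = "\<lambda>\<sigma>. \<not> f \<sigma> \<and> f' \<sigma>"
  have "dual_rail V N ?F"
    using assms by (intro dual_rail_not) auto
  then have "dual_rail V (N + 2 + 2) (insert ?b (insert ?a ?F))"
    using assms by (intro dual_rail_conj) auto
  then have "dual_rail V (N + 2 + 2 + 2) (insert (\<lambda>\<sigma>. ?a \<sigma> \<or> ?b \<sigma>) (insert ?b (insert ?a ?F)))"
    by (rule dual_rail_disj) auto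
  moreover have "(\<lambda>\<sigma>. ?a \<sigma> \<or> ?b \<sigma>) = (\<lambda>\<sigma>. f \<sigma> \<noteq> f' \<sigma>)"
    by blast
  ultimately show ?thesis
    by (auto elim: dual_rail_mono)
qed

text \<open>The step hypothesis ranges over all extensions \<open>F'\<close> of \<open>F\<close>,
  since the earlier \<open>h i\<close> have been added by then.\<close>

lemma dual_rail_family:
  assumes "dual_rail V N F"
    and "\<And>i N F'. i < m \<Longrightarrow> dual_rail V N F' \<Longrightarrow> F \<subseteq> F' \<Longrightarrow> dual_rail V (N + c) (insert (h i) F')"
  shows "dual_rail V (N + m * c) (F \<union> h ` {..<m})"
proof -
  have "k \<le> m \<Longrightarrow> dual_rail V (N + k * c) (F \<union> h ` {..<k})" for k
  proof (induction k)
    case 0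
    then show ?case using assms(1) by simp
  next
    case (Suc k)
    then have "dual_rail V (N + k * c + c) (insert (h k) (F \<union> h ` {..<k}))"
      by (intro assms(2)) auto
    then show ?case
      by (simp add: lessThan_Suc algebra_simps)
  qed
  then show ?thesis by simp
qed

lemma dual_rail_all:
  assumes "dual_rail V N F" "\<And>i. i < m \<Longrightarrow> f i \<in> F"
  shows "dual_rail V (N + 2 + m * 2) (insert (\<lambda>\<sigma>. \<forall>i<m. f i \<sigma>) F)"
  using assms(2)
proof (induction m)
  case 0
  then show ?case using dual_rail_const[OF assms(1), of True] by simp
next
  case (Suc m)
  then have "dual_rail V (N + 2 + m * 2) (insert (\<lambda>\<sigma>. \<forall>i<m. f i \<sigma>) F)"
    by simp
  from dual_rail_conj[OF this, of "f m" "\<lambda>\<sigma>. \<forall>i<m. f i \<sigma>"] Suc.prems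
  show ?case
    by (auto simp: less_Suc_eq all_conj_distrib conj_commute imp_conjR disj_imp elim!: dual_rail_mono)
qed


section \<open>Circuits for addition and multiplication\<close>

text \<open>The carry into position \<open>k\<close> when \<open>a\<close> and \<open>b\<close> are
  added in binary.\<close>

definition carry :: "nat \<Rightarrow> nat \<Rightarrow> nat \<Rightarrow> bool" where
  "carry a b k \<longleftrightarrow> 2 ^ k \<le> take_bit k a + take_bit k b"

lemma carry_0 [simp]: "\<not> carry a b 0"
  by (simp add: carry_def)

text \<open>These are the full adder equations. The bits at \<open>k\<close> contribute multiples of
  \<open>p = 2 ^ k\<close> to the sum \<open>s\<close> of the lower parts; as
  \<open>s < 2 * p\<close>, a finite case split remains.\<close>

lemma bit_add_carry:
  fixes a b :: nat
  shows "bit (a + b) k \<longleftrightarrow> ((bit a k \<noteq> bit b k) \<noteq> carry a b k)" (is ?sum)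
    and "carry a b (Suc k) \<longleftrightarrow> bit a k \<and> bit b k \<or> (bit a k \<noteq> bit b k) \<and> carry a b k" (is ?carry)
proof -
  define s where "s = take_bit k a + take_bit k b"
  define p :: nat where "p = 2 ^ k"
  have s: "s < 2 * p" 
    unfolding s_def p_def using take_bit_nat_less_exp[of k a] take_bit_nat_less_exp[of k b] by linarith
  have split: "take_bit (Suc k) x = take_bit k x + p * of_bool (bit x k)" for x :: nat
    by (simp add: take_bit_Suc_from_most p_def)
  have "take_bit (Suc k) (a + b) = (s + p * of_bool (bit a k) + p * of_bool (bit b k)) mod (2 * p)"
    unfolding s_def using split[of a] split[of b]
    by (metis (no_types, lifting) take_bit_add take_bit_eq_mod add.assoc add.left_commute p_def power_Suc)
  moreover have "bit (a + b) k \<longleftrightarrow> p \<le> take_bit (Suc k) (a + b)"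
    using split[of "a + b"] take_bit_nat_less_exp[of k "a + b"] by (auto simp: p_def dest: leD)
  moreover have "s + p * of_bool (bit a k) + p * of_bool (bit b k) < 4 * p"
    using s by (auto simp: of_bool_def)
  ultimately show ?sum
    using s by (auto simp: carry_def of_bool_def p_def[symmetric] s_def[symmetric] mod_if)
  show ?carry
    using s split[of a] split[of b]
    by (auto simp: carry_def of_bool_def p_def[symmetric] s_def[symmetric])
qed

lemma dual_rail_add:
  fixes a b :: "('v \<Rightarrow> bool) \<Rightarrow> nat"
  assumes "dual_rail V N F"
    and a: "\<And>k. k < K \<Longrightarrow> (\<lambda>\<sigma>. bit (a \<sigma>) k) \<in> F"
    and b: "\<And>k. k < K \<Longrightarrow> (\<lambda>\<sigma>. bit (b \<sigma>) k) \<in> F"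
  shows "dual_rail V (N + 2 + K * 18) (F \<union> (\<lambda>k \<sigma>. bit (a \<sigma> + b \<sigma>) k) ` {..<K})"
proof -
  let ?s = "\<lambda>k \<sigma>. bit (a \<sigma> + b \<sigma>) k" and ?c = "\<lambda>k \<sigma>. carry (a \<sigma>) (b \<sigma>) k"
  \<comment> \<open>Ripple carry: besides the sum bits only the current carry is kept. The 18 gates
    per bit are two xors of 6 and three connectives of 2.\<close>
  have "k \<le> K \<Longrightarrow> dual_rail V (N + 2 + k * 18) (insert (?c k) (F \<union> ?s ` {..<k}))" for k
  proof (induction k)
    case 0
    then show ?case
      using dual_rail_const[OF assms(1), of False] by simp
  next
    case (Suc k)
    let ?F = "insert (?c k) (F \<union> ?s ` {..<k})"
    let ?a = "\<lambda>\<sigma>. bit (a \<sigma>) k" and ?b = "\<lambda>\<sigma>. bit (b \<sigma>) k"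
    let ?x = "\<lambda>\<sigma>. ?a \<sigma> \<noteq> ?b \<sigma>" and ?d = "\<lambda>\<sigma>. ?a \<sigma> \<and> ?b \<sigma>" 
    let ?e = "\<lambda>\<sigma>. ?x \<sigma> \<and> ?c k \<sigma>"
    have s: "?s k = (\<lambda>\<sigma>. ?x \<sigma> \<noteq> ?c k \<sigma>)" and c: "?c (Suc k) = (\<lambda>\<sigma>. ?d \<sigma> \<or> ?e \<sigma>)"
      by (simp_all add: bit_add_carry)
    have mem: "?a \<in> ?F" "?b \<in> ?F"
      using a b Suc.prems by auto
    have "dual_rail V (N + 2 + k * 18) ?F"
      using Suc by simp
    then have "dual_rail V (N + 2 + k * 18 + 6) (insert ?x ?F)"
      using mem by (intro dual_rail_xor) auto
    then have "dual_rail V (N + 2 + k * 18 + 6 + 6) (insert (?s k) (insert ?x ?F))"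
      unfolding s by (rule dual_rail_xor) auto
    then have "dual_rail V (N + 2 + k * 18 + 6 + 6 + 2) (insert ?d (insert (?s k) (insert ?x ?F)))"
      using mem by (intro dual_rail_conj) auto
    then have "dual_rail V (N + 2 + k * 18 + 6 + 6 + 2 + 2)
        (insert ?e (insert ?d (insert (?s k) (insert ?x ?F))))"
      by (rule dual_rail_conj) auto
    then have "dual_rail V (N + 2 + k * 18 + 6 + 6 + 2 + 2 + 2)
        (insert (?c (Suc k)) (insert ?e (insert ?d (insert (?s k) (insert ?x ?F)))))"
      unfolding c by (rule dual_rail_disj) auto
    then show ?case
      by (rule dual_rail_mono) (auto simp: lessThan_Suc)
  qed
  from this[of K] show ?thesis
    by (auto elim: dual_rail_mono)
qed

text \<open>Schoolbook multiplication, one row for each bit of \<open>b\<close>, with only the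
  lowest \<open>K\<close> bits tracked. A row costs \<open>K * 2\<close> gates for its bits and
  \<open>2 + K * 18\<close> for adding it.\<close>

lemma dual_rail_mult:
  fixes a b :: "('v \<Rightarrow> bool) \<Rightarrow> nat"
  assumes "dual_rail V N F"
    and a: "\<And>k. k < K \<Longrightarrow> (\<lambda>\<sigma>. bit (a \<sigma>) k) \<in> F"
    and b: "\<And>k. k < R \<Longrightarrow> (\<lambda>\<sigma>. bit (b \<sigma>) k) \<in> F"
  shows "dual_rail V (N + K * 2 + R * (2 + K * 20))
     (F \<union> (\<lambda>k \<sigma>. bit (a \<sigma> * take_bit R (b \<sigma>)) k) ` {..<K})"
  using b
proof (induction R)
  case 0
  have "dual_rail V (N + K * 2) (F \<union> (\<lambda>k \<sigma>. False) ` {..<K})"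
    using assms(1) by (rule dual_rail_family) (rule dual_rail_const)
  then show ?case by simp
next
  case (Suc R)
  let ?p = "\<lambda>\<sigma>. a \<sigma> * take_bit R (b \<sigma>)"
  let ?row = "\<lambda>\<sigma>. a \<sigma> * (2 ^ R * of_bool (bit (b \<sigma>) R))"
  let ?F = "F \<union> (\<lambda>k \<sigma>. bit (?p \<sigma>) k) ` {..<K}"
  let ?N = "N + K * 2 + R * (2 + K * 20)"
  \<comment> \<open>The row is \<open>a\<close> shifted by \<open>R\<close>, or zero; its bits below
    \<open>R\<close> are constantly false.\<close>
  have row: "bit (?row \<sigma>) k \<longleftrightarrow> bit (b \<sigma>) R \<and> R \<le> k \<and> bit (a \<sigma>) (k - R)" for \<sigma> k
  proof -
    have "?row \<sigma> = (if bit (b \<sigma>) R then push_bit R (a \<sigma>) else 0)"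
      by (simp add: push_bit_eq_mult)
    then show ?thesis by (simp add: bit_push_bit_iff_nat)
  qed
  have "dual_rail V ?N ?F"
    using Suc by simp
  then have "dual_rail V (?N + K * 2) (?F \<union> (\<lambda>k \<sigma>. bit (?row \<sigma>) k) ` {..<K})"
  proof (rule dual_rail_family)
    fix k N' F' assume k: "k < K" and F': "dual_rail V N' F'" "?F \<subseteq> F'"
    show "dual_rail V (N' + 2) (insert (\<lambda>\<sigma>. bit (?row \<sigma>) k) F')"
    proof (cases "R \<le> k")
      case True
      moreover have "(\<lambda>\<sigma>. bit (b \<sigma>) R) \<in> F'" "(\<lambda>\<sigma>. bit (a \<sigma>) (k - R)) \<in> F'"
        using k F'(2) Suc.prems a by auto
      ultimately show ?thesis
        unfolding row using dual_rail_conj[OF F'(1)] by simp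
    next
      case False
      then show ?thesis
        unfolding row using dual_rail_const[OF F'(1), of False] by simp
    qed
  qed
  then have "dual_rail V (?N + K * 2 + 2 + K * 18) (?F \<union> (\<lambda>k \<sigma>. bit (?row \<sigma>) k) ` {..<K} \<union>
      (\<lambda>k \<sigma>. bit (?p \<sigma> + ?row \<sigma>) k) ` {..<K})"
    by (rule dual_rail_add) auto
  moreover have "?p \<sigma> + ?row \<sigma> = a \<sigma> * take_bit (Suc R) (b \<sigma>)" for \<sigma>
    by (simp add: take_bit_Suc_from_most distrib_left)
  ultimately show ?case
    by (auto elim!: dual_rail_mono)
qed

section \<open>Numbers given by variables, and a program for the multiplication relation\<close>

lemma bit_num_of: "bit (num_of U m \<sigma>) k \<longleftrightarrow> k < m \<and> \<sigma> (U (Suc k))"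
  by (auto simp: num_of_def bit_horner_sum_bit_iff simp del: upt_Suc)

lemma num_of_less: "num_of U m \<sigma> < 2 ^ m"
  using horner_sum_of_bool_2_less[of "map (\<lambda>i. \<sigma> (U i)) [1..<Suc m]"]
  by (simp add: num_of_def del: upt_Suc)

text \<open>Positions from \<open>m\<close> on are constantly false, which pads a factor to the
  width of the product.\<close>

lemma dual_rail_num_of:
  assumes "dual_rail V N F" "\<And>i. i \<in> {1..m} \<Longrightarrow> U i \<in> V"
  shows "dual_rail V (N + K * 2) (F \<union> (\<lambda>k \<sigma>. bit (num_of U m \<sigma>) k) ` {..<K})"
  using assms(1)
proof (rule dual_rail_family)
  fix k N' F' assume "dual_rail V N' F'"
  then show "dual_rail V (N' + 2) (insert (\<lambda>\<sigma>. bit (num_of U m \<sigma>) k) F')"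
    using dual_rail_const[of V N' F' False] dual_rail_var[of V N' F' "U (Suc k)"] assms(2)
    by (cases "k < m") (auto simp: bit_num_of)
qed

lemma computed_mult_rel:
  assumes "1 \<le> n" "1 \<le> l" "j \<le> 2 * n"
  shows "computed (out_vars n \<union> in_vars n) (80 * n ^ 2) {mult_rel n l j}"
proof -
  let ?V = "out_vars n \<union> in_vars n"
  let ?x = "num_of Xv n" and ?y = "num_of Yv n" and ?i = "num_of Iv (2 * n)"
  let ?in = "(\<lambda>k \<sigma>. bit (?x \<sigma>) k) ` {..<2 * n} \<union> (\<lambda>k \<sigma>. bit (?y \<sigma>) k) ` {..<2 * n} \<union>
    (\<lambda>k \<sigma>. bit (?i \<sigma>) k) ` {..<2 * n}"
  let ?d = "\<lambda>k \<sigma>. bit (?x \<sigma> * ?y \<sigma>) k \<noteq> bit (?i \<sigma>) k"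
  have "dual_rail ?V (0 + 2 * n * 2 + 2 * n * 2 + 2 * n * 2) ({} \<union> ?in)"
    unfolding Un_assoc[symmetric]
    by (intro dual_rail_num_of dual_rail_empty) (auto simp: out_vars_def in_vars_def)
  then have "dual_rail ?V (12 * n) ?in"
    by simp
  then have "dual_rail ?V (12 * n + 2 * n * 2 + n * (2 + 2 * n * 20))
      (?in \<union> (\<lambda>k \<sigma>. bit (?x \<sigma> * take_bit n (?y \<sigma>)) k) ` {..<2 * n})"
    by (rule dual_rail_mult) auto
  \<comment> \<open>Since \<open>Y\<close> has \<open>n\<close> bits, \<open>n\<close> rows give the
    full product.\<close>
  moreover have "take_bit n (?y \<sigma>) = ?y \<sigma>" for \<sigma>
    by (simp add: take_bit_nat_eq_self num_of_less)
  ultimately have "dual_rail ?V (18 * n + 40 * n * n)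
      (?in \<union> (\<lambda>k \<sigma>. bit (?x \<sigma> * ?y \<sigma>) k) ` {..<2 * n})" (is "dual_rail _ ?N ?F")
    by (simp add: algebra_simps)
  then have "dual_rail ?V (?N + 2 * n * 6) (?F \<union> (\<lambda>k \<sigma>. \<not> ?d k \<sigma>) ` {..<2 * n})"
  proof (rule dual_rail_family)
    fix k N' F' assume k: "k < 2 * n" and F': "dual_rail ?V N' F'" "?F \<subseteq> F'"
    then have "dual_rail ?V (N' + 6) (insert (?d k) F')"
      by (intro dual_rail_xor) auto
    \<comment> \<open>Equality of two bits is the negation of their xor and thus costs nothing
      more.\<close>
    then have "dual_rail ?V (N' + 6) (insert (\<lambda>\<sigma>. \<not> ?d k \<sigma>) (insert (?d k) F'))"
      by (rule dual_rail_not) simp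
    then show "dual_rail ?V (N' + 6) (insert (\<lambda>\<sigma>. \<not> ?d k \<sigma>) F')"
      by (rule dual_rail_mono) auto
  qed
  then have "dual_rail ?V (?N + 2 * n * 6 + 2 + (Suc j - l) * 2)
      (insert (\<lambda>\<sigma>. \<forall>k < Suc j - l. \<not> ?d (k + (l - 1)) \<sigma>) (?F \<union> (\<lambda>k \<sigma>. \<not> ?d k \<sigma>) ` {..<2 * n}))"
  proof (rule dual_rail_all)
    fix k assume "k < Suc j - l"
    then have "k + (l - 1) < 2 * n" using assms by simp
    then show "(\<lambda>\<sigma>. \<not> ?d (k + (l - 1)) \<sigma>) \<in> ?F \<union> (\<lambda>k \<sigma>. \<not> ?d k \<sigma>) ` {..<2 * n}"
      by blast
  qed
  \<comment> \<open>Here \<open>k\<close> counts from \<open>0\<close>; the offset is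
    \<open>l - 1\<close> rather than \<open>l\<close> because \<open>bit\<close> counts from
    \<open>0\<close> and \<open>mult_rel\<close> from \<open>1\<close>.\<close>
  moreover have "(\<lambda>\<sigma>. \<forall>k < Suc j - l. \<not> ?d (k + (l - 1)) \<sigma>) = mult_rel n l j"
  proof (rule ext)
    fix \<sigma>
    have "x \<in> (\<lambda>k. k + l) ` {..<Suc j - l}" if "x \<in> {l..j}" for x
      using that by (intro image_eqI[of _ _ "x - l"]) auto
    then have img: "{l..j} = (\<lambda>k. k + l) ` {..<Suc j - l}"
      by auto
    have "mult_rel n l j \<sigma> \<longleftrightarrow> (\<forall>k\<in>{l..j}. \<not> ?d (k - 1) \<sigma>)"
      by (simp add: mult_rel_def)
    also note img
    finally show "(\<forall>k < Suc j - l. \<not> ?d (k + (l - 1)) \<sigma>) = mult_rel n l j \<sigma>"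
      using assms(2) by auto
  qed
  moreover have "?N + 2 * n * 6 + 2 + (Suc j - l) * 2 \<le> 80 * n ^ 2"
  proof -
    have "n \<le> n * n" by simp
    have "?N + 2 * n * 6 + 2 + (Suc j - l) * 2 \<le> 40 * n * n + 34 * n + 2"
      using assms by auto
    also have "\<dots> \<le> 80 * n ^ 2"
      using assms(1) \<open>n \<le> n * n\<close> unfolding power2_eq_square by linarith
    finally show ?thesis .
  qed
  ultimately show ?thesis
    unfolding dual_rail_def by (auto elim!: computed_mono)
qed


section \<open>Disjunction with guarded terms\<close>

text \<open>NNF circuits contain only descendants of the root, whereas a program may have gates that
  its output does not reach.\<close>

definition reach_circuit :: "'a \<Rightarrow> ('a \<Rightarrow> ('a, 'v) gate) \<Rightarrow> ('a, 'v) circuit" where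
  "reach_circuit r g =
     \<lparr>nodes = {x. (r, x) \<in> {(x, y). y \<in> children (g x)}\<^sup>*}, root = r, gate = g\<rparr>"

lemma reach_circuit_sel [simp]:
  "root (reach_circuit r g) = r" "gate (reach_circuit r g) = g"
  by (simp_all add: reach_circuit_def)

lemma root_reach_circuit: "r \<in> nodes (reach_circuit r g)"
  by (simp add: reach_circuit_def)

lemma child_reach_circuit:
  "x \<in> nodes (reach_circuit r g) \<Longrightarrow> y \<in> children (g x) \<Longrightarrow> y \<in> nodes (reach_circuit r g)"
  by (auto simp: reach_circuit_def intro: rtrancl_into_rtrancl)

lemma nodes_reach_circuit_subset:
  assumes "r \<in> N" "\<And>x. x \<in> N \<Longrightarrow> children (g x) \<subseteq> N"
  shows "nodes (reach_circuit r g) \<subseteq> N"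
proof
  fix x assume "x \<in> nodes (reach_circuit r g)"
  then have "(r, x) \<in> {(x, y). y \<in> children (g x)}\<^sup>*"
    by (simp add: reach_circuit_def)
  then show "x \<in> N"
    by induction (use assms in auto)
qed

text \<open>A rank that falls along every edge yields acyclicity; a finite child-closed
  \<open>N\<close> containing the root bounds the node set.\<close>

lemma nnf_reach_circuit:
  fixes rank :: "'a \<Rightarrow> nat"
  assumes N: "finite N" "r \<in> N" "\<And>x. x \<in> N \<Longrightarrow> children (g x) \<subseteq> N"
    and rank: "\<And>x y. x \<in> N \<Longrightarrow> y \<in> children (g x) \<Longrightarrow> rank y < rank x"
    and proper: "\<And>x. x \<in> N \<Longrightarrow> proper_gate (g x)"
  shows "nnf_circuit (reach_circuit r g)"
proof -
  let ?G = "reach_circuit r g"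
  have sub: "nodes ?G \<subseteq> N"
    using N by (intro nodes_reach_circuit_subset)
  have "edges ?G \<subseteq> (measure rank)\<inverse>"
    using rank sub by (auto simp: edges_def)
  then have "acyclic (edges ?G)"
    by (meson acyclic_converse acyclic_subset wf_acyclic wf_measure)
  \<comment> \<open>The closure that defines the nodes uses all child pairs, \<open>edges\<close>
    only those leaving a node; on a path from the root every pair is of the latter kind.\<close>
  moreover have "(r, x) \<in> (edges ?G)\<^sup>*" if "x \<in> nodes ?G" for x
  proof -
    have "(r, x) \<in> {(x, y). y \<in> children (g x)}\<^sup>*"
      using that by (simp add: reach_circuit_def)
    then have "(r, x) \<in> (edges ?G)\<^sup>* \<and> x \<in> nodes ?G"
    proof induction
      case base
      then show ?case by (simp add: root_reach_circuit)
    next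
      case (step y z)
      then have "(y, z) \<in> edges ?G" "z \<in> nodes ?G"
        by (auto simp: edges_def intro: child_reach_circuit)
      with step show ?case by (auto intro: rtrancl_into_rtrancl)
    qed
    then show ?thesis ..
  qed
  moreover have "\<forall>x \<in> nodes ?G. \<forall>y z. gate ?G x = And y z \<or> gate ?G x = Or y z \<longrightarrow> y \<noteq> z"
    using sub proper unfolding proper_gate_def reach_circuit_sel by blast
  ultimately show ?thesis
    unfolding nnf_circuit_def
    using sub N(1)
    by (auto simp: root_reach_circuit edges_def intro: finite_subset child_reach_circuit)
qed

section \<open>Relabelling of leaves\<close>

lemma relabel_sel [simp]:
  "nodes (relabel f G) = nodes G" "root (relabel f G) = root G"
  "gate (relabel f G) x = relabel_gate (f x) (gate G x)"
  by (simp_all add: relabel_def)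

lemma relabel_gate_relabel_gate: "relabel_gate f (relabel_gate g h) = relabel_gate (\<lambda>a. f (g a)) h"
  by (cases h) auto

lemma relabel_relabel: "relabel f (relabel g G) = relabel (\<lambda>x a. f x (g x a)) G"
  by (simp add: relabel_def relabel_gate_relabel_gate)

text \<open>Gates are monotone, so an implication between leaf values on a child-closed set
  propagates upwards. Two relabellings and two assignments allow comparison before and after a
  change.\<close>

lemma true_at_relabel_mono:
  assumes "true_at (relabel h G) \<tau> x" "x \<in> N"
    and "\<And>y. y \<in> N \<Longrightarrow> children (gate G y) \<subseteq> N"
    and "\<And>y a. y \<in> N \<Longrightarrow> gate G y = Leaf a \<Longrightarrow> leaf_true \<tau> (h y a) \<Longrightarrow> leaf_true \<tau>' (h' y a)"
  shows "true_at (relabel h' G) \<tau>' x"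
  using assms(1,2)
proof induction
  case (1 x a)
  then show ?case
    using assms(4) by (cases "gate G x") (auto simp: true_at_iff)
next
  case (2 x y z)
  then have "gate G x = And y z" by (cases "gate G x") auto
  with 2 assms(3)[of x] show ?case by (auto simp: true_at_iff(2)[where y = y and z = z])
next
  case (3 x y z)
  then have "gate G x = Or y z" by (cases "gate G x") auto
  with 3 assms(3)[of x] show ?case by (auto simp: true_at_iff(3)[where y = y and z = z])
next
  case (4 x y z)
  then have "gate G x = Or y z" by (cases "gate G x") auto
  with 4 assms(3)[of x] show ?case by (auto simp: true_at_iff(3)[where y = y and z = z])
qed

text \<open>
  \<open>Base\<close> embeds the given program; \<open>Term t i\<close> is the conjunction of the first \<open>i\<close> factors of the
  term \<open>t\<close>, and \<open>Alt t\<close> the disjunction of the first \<open>t\<close> terms.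
\<close>

datatype node = Base nat
  | PosLit nat nat | NegLit nat nat | PosGuard nat nat | NegGuard nat nat
  | PosArm nat nat | NegArm nat nat | Factor nat nat | Term nat nat | Alt nat | Top

text \<open>Countability lets \<open>to_nat\<close> code the structured nodes as natural
  numbers.\<close>

instance node :: countable
  by countable_datatype

lemma lit_true_Old: "lit_true \<tau> (map_lit Old u) = lit_true (\<lambda>v. \<tau> (Old v)) u"
  by (cases u) auto

lemma var_of_compl: "var_of (compl u) = var_of u"
  by (cases u) auto

text \<open>\<open>sound\<close> allows the terms as disjuncts without changing the function;
  \<open>complete\<close> frees the result of outputs once the output leaves of the terms are true.
  By injectivity of \<open>z\<close>, an output variable occurs in only one factor of each
  term.\<close>

locale guarded_terms =
  fixes V :: "'v set" and g :: "nat \<Rightarrow> (nat, 'v) gate" and val :: "nat \<Rightarrow> ('v \<Rightarrow> bool) \<Rightarrow> bool"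
    and r T m :: nat and z :: "nat \<Rightarrow> 'v" and A B :: "nat \<Rightarrow> nat \<Rightarrow> 'v leaf"
  assumes prog: "program V (Suc r) g val"
    and pos: "0 < T" "0 < m"
    and z: "inj_on z {..<m}" "z ` {..<m} \<subseteq> V"
    and guard: "\<And>t i u. t < T \<Longrightarrow> i < m \<Longrightarrow> A t i = Lit u \<or> B t i = Lit u \<Longrightarrow>
        var_of u \<in> V - z ` {..<m}"
    and sound: "\<And>t \<sigma>. t < T \<Longrightarrow>
        (\<And>i. i < m \<Longrightarrow> \<sigma> (z i) \<and> leaf_true \<sigma> (A t i) \<or> \<not> \<sigma> (z i) \<and> leaf_true \<sigma> (B t i)) \<Longrightarrow>
        val r \<sigma>"
    and complete: "\<And>\<sigma>. val r \<sigma> \<Longrightarrow> \<exists>t<T. \<forall>i<m. leaf_true \<sigma> (A t i) \<or> leaf_true \<sigma> (B t i)"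
begin

text \<open>The gates of \<open>PosLit t i\<close> and \<open>NegLit t i\<close> ignore
  \<open>t\<close>: every term owns copies of the output leaves, so that each copy affects a single
  factor of a single term.\<close>

fun node_gate :: "node \<Rightarrow> (node, 'v) gate" where
  "node_gate (Base k) = map_gate Base id (g k)"
| "node_gate (PosLit t i) = Leaf (Lit (Pos (z i)))"
| "node_gate (NegLit t i) = Leaf (Lit (Neg (z i)))"
| "node_gate (PosGuard t i) = Leaf (A t i)"
| "node_gate (NegGuard t i) = Leaf (B t i)"
| "node_gate (PosArm t i) = And (PosLit t i) (PosGuard t i)"
| "node_gate (NegArm t i) = And (NegLit t i) (NegGuard t i)"
| "node_gate (Factor t i) = Or (PosArm t i) (NegArm t i)"
| "node_gate (Term t 0) = Leaf (Cst True)"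
| "node_gate (Term t (Suc i)) = And (Term t i) (Factor t i)"
| "node_gate (Alt 0) = Leaf (Cst False)"
| "node_gate (Alt (Suc t)) = Or (Alt t) (Term t m)"
| "node_gate Top = Or (Base r) (Alt T)"

definition G :: "(nat, 'v) circuit" where
  "G = reach_circuit (to_nat Top) (\<lambda>x. map_gate to_nat id (node_gate (from_nat x)))"

fun valid :: "node \<Rightarrow> bool" where
  "valid (Base k) \<longleftrightarrow> k \<le> r"
| "valid (Term t i) \<longleftrightarrow> t < T \<and> i \<le> m"
| "valid (Alt t) \<longleftrightarrow> t \<le> T"
| "valid Top \<longleftrightarrow> True"
| "valid (PosLit t i) \<longleftrightarrow> t < T \<and> i < m"
| "valid (NegLit t i) \<longleftrightarrow> t < T \<and> i < m"
| "valid (PosGuard t i) \<longleftrightarrow> t < T \<and> i < m"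
| "valid (NegGuard t i) \<longleftrightarrow> t < T \<and> i < m"
| "valid (PosArm t i) \<longleftrightarrow> t < T \<and> i < m"
| "valid (NegArm t i) \<longleftrightarrow> t < T \<and> i < m"
| "valid (Factor t i) \<longleftrightarrow> t < T \<and> i < m"

text \<open>The offsets order arms, factors, terms, alternatives and \<open>Top\<close>; the summand
  \<open>r\<close> puts \<open>Top\<close> above the base program as well.\<close>

fun rank :: "node \<Rightarrow> nat" where
  "rank (Base k) = k"
| "rank (Term t i) = 3 + i"
| "rank (Alt t) = 4 + m + t"
| "rank Top = 5 + m + T + r"
| "rank (PosArm t i) = 1"
| "rank (NegArm t i) = 1"
| "rank (Factor t i) = 2"
| "rank _ = 0"

section \<open>Well-formedness and size of the circuit with guarded terms\<close>

lemma children_map_gate: "children (map_gate f k h) = f ` children h"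
  by (cases h) auto

lemma base_children: "k \<le> r \<Longrightarrow> children (g k) \<subseteq> {..<k}"
  using prog by (auto simp: program_def)

lemma valid_child: "valid x \<Longrightarrow> y \<in> children (node_gate x) \<Longrightarrow> valid y \<and> rank y < rank x"
  by (induction x rule: node_gate.induct) (use base_children in \<open>fastforce simp: children_map_gate\<close>)+

lemma valid_proper: "valid x \<Longrightarrow> proper_gate (node_gate x)"
proof (induction x rule: node_gate.induct)
  case (1 k)
  then have "proper_gate (g k)" using prog by (simp add: program_def)
  then show ?case by (cases "g k") auto
qed auto

lemma valid_subset: "{x. valid x} \<subseteq> Base ` {..r} \<union> case_prod PosLit ` ({..<T} \<times> {..<m}) \<union>
    case_prod NegLit ` ({..<T} \<times> {..<m}) \<union> case_prod PosGuard ` ({..<T} \<times> {..<m}) \<union>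
    case_prod NegGuard ` ({..<T} \<times> {..<m}) \<union> case_prod PosArm ` ({..<T} \<times> {..<m}) \<union>
    case_prod NegArm ` ({..<T} \<times> {..<m}) \<union> case_prod Factor ` ({..<T} \<times> {..<m}) \<union>
    case_prod Term ` ({..<T} \<times> {..m}) \<union> Alt ` {..T} \<union> {Top}" (is "_ \<subseteq> ?N")
proof
  fix x assume "x \<in> {x. valid x}"
  then show "x \<in> ?N"
    by (cases x) (auto simp: image_iff split: prod.splits)
qed

lemma finite_valid: "finite {x. valid x}"
  by (rule finite_subset[OF valid_subset]) auto

text \<open>Seven kinds of node come in \<open>T * m\<close> copies, and \<open>Term\<close> adds
  \<open>T * Suc m\<close>.\<close>

lemma card_valid: "card {x. valid x} \<le> r + 3 + T * (8 * m + 2)"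
proof -
  have img: "card (f ` S) \<le> c" if "finite S" "card S \<le> c" for f :: "'b \<Rightarrow> node" and S c
    using that card_image_le le_trans by blast
  have un: "card (S \<union> S') \<le> a + b" if "card S \<le> a" "card S' \<le> b" for S S' :: "node set" and a b
    using that card_Un_le[of S S'] by linarith
  have "card {x. valid x} \<le> Suc r + T * m + T * m + T * m + T * m + T * m + T * m + T * m +
      T * Suc m + Suc T + 1"
    by (rule le_trans[OF card_mono[OF _ valid_subset]], simp, intro un img)
       (simp_all add: card_cartesian_product)
  also have "\<dots> = r + 3 + T * (8 * m + 2)"
    by (simp add: algebra_simps)
  finally show ?thesis .
qed

lemma nnf_circuit_G: "nnf_circuit G"
  unfolding G_def
proof (rule nnf_reach_circuit)
  show "finite (to_nat ` {x. valid x})"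
    using finite_valid by simp
  show "to_nat Top \<in> to_nat ` {x. valid x}" by auto
  show "children (map_gate to_nat id (node_gate (from_nat x))) \<subseteq> to_nat ` {x. valid x}"
    if "x \<in> to_nat ` {x. valid x}" for x
    using that valid_child by (auto simp: children_map_gate)
  show "(rank \<circ> from_nat) y < (rank \<circ> from_nat) x"
    if "x \<in> to_nat ` {x. valid x}" "y \<in> children (map_gate to_nat id (node_gate (from_nat x)))" for x y
    using that valid_child by (auto simp: children_map_gate)
  show "proper_gate (map_gate to_nat id (node_gate (from_nat x)))"
    if "x \<in> to_nat ` {x. valid x}" for x
  proof -
    have "proper_gate (node_gate (from_nat x))" using that valid_proper by auto
    then show ?thesis by (cases "node_gate (from_nat x)") auto
  qed
qed

lemma nodes_subset: "nodes G \<subseteq> to_nat ` {x. valid x}"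
  unfolding G_def
  by (rule nodes_reach_circuit_subset) (use valid_child in \<open>auto simp: children_map_gate\<close>)

lemma circuit_size_G: "circuit_size G \<le> r + 3 + T * (8 * m + 2)"
proof -
  have "circuit_size G \<le> card {x. valid x}"
    unfolding circuit_size_def using surj_card_le[OF finite_valid nodes_subset] .
  with card_valid show ?thesis by linarith
qed

section \<open>Nodes, variables and evaluation of the circuit\<close>

lemma gate_G [simp]: "gate G (to_nat x) = map_gate to_nat id (node_gate x)"
  by (simp add: G_def)

lemma root_G [simp]: "root G = to_nat Top"
  by (simp add: G_def)

lemma child_in_nodes:
  "to_nat x \<in> nodes G \<Longrightarrow> y \<in> children (node_gate x) \<Longrightarrow> to_nat y \<in> nodes G"
  unfolding G_def by (erule child_reach_circuit) (simp add: children_map_gate)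

text \<open>Only what the root reaches is a node, so membership is traced downwards from
  \<open>Top\<close>, later through the terms to their literals.\<close>

lemma Base_in_nodes: "to_nat (Base r) \<in> nodes G"
  and Alt_in_nodes: "t \<le> T \<Longrightarrow> to_nat (Alt t) \<in> nodes G"
proof -
  have Top: "to_nat Top \<in> nodes G"
    by (simp add: G_def root_reach_circuit)
  then show "to_nat (Base r) \<in> nodes G"
    by (rule child_in_nodes) simp
  show "t \<le> T \<Longrightarrow> to_nat (Alt t) \<in> nodes G"
  proof (induction t rule: inc_induct)
    case base
    from Top show ?case by (rule child_in_nodes) simp
  next
    case (step t)
    then show ?case by (auto elim: child_in_nodes)
  qed
qed

lemma Term_in_nodes:
  assumes "t < T" "i \<le> m"
  shows "to_nat (Term t i) \<in> nodes G"
  using assms(2)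
proof (induction i rule: inc_induct)
  case base
  from assms(1) have "to_nat (Alt (Suc t)) \<in> nodes G" by (intro Alt_in_nodes) simp
  then show ?case by (rule child_in_nodes) simp
next
  case (step i)
  then show ?case by (auto elim: child_in_nodes)
qed

lemma literal_in_nodes:
  assumes "t < T" "i < m"
  shows "to_nat (PosLit t i) \<in> nodes G" "to_nat (NegLit t i) \<in> nodes G"
proof -
  have "to_nat (Term t (Suc i)) \<in> nodes G"
    using assms by (intro Term_in_nodes) auto
  then have f: "to_nat (Factor t i) \<in> nodes G"
    by (rule child_in_nodes) simp
  have "to_nat (PosArm t i) \<in> nodes G" "to_nat (NegArm t i) \<in> nodes G"
    by (rule child_in_nodes[OF f]; simp)+
  from child_in_nodes[OF this(1)] child_in_nodes[OF this(2)]
  show "to_nat (PosLit t i) \<in> nodes G" "to_nat (NegLit t i) \<in> nodes G"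
    by simp_all
qed

lemma circuit_vars_G: "circuit_vars G \<subseteq> V"
proof -
  have "var_of u \<in> V" if x: "x \<in> nodes G" "gate G x = Leaf (Lit u)" for x u
  proof -
    obtain y where y: "x = to_nat y" "valid y"
      using x nodes_subset by auto
    show ?thesis
    proof (cases y)
      case (Base k)
      then have "gate_over V (g k)" using y prog by (simp add: program_def)
      with Base x y show ?thesis by (cases "g k") (auto simp: leaf.map_id)
    next
      case (Term t i)
      with x y show ?thesis by (cases i) auto
    next
      case (Alt t)
      with x y show ?thesis by (cases t) auto
    next
      case (PosGuard t i)
      with x y guard[of t i u] show ?thesis by (auto simp: leaf.map_id)
    next
      case (NegGuard t i)
      with x y guard[of t i u] show ?thesis by (auto simp: leaf.map_id)
    qed (use x y z in \<open>auto simp: leaf.map_id image_subset_iff\<close>)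
  qed
  then show ?thesis
    unfolding circuit_vars_def lit_leaves_def by fastforce
qed

text \<open>Stated for any relabelling, even into other variables, to cover the circuit itself, its
  switched form and its split form. The constants appear through \<open>lv\<close> because
  \<open>h\<close> may relabel them too.\<close>

lemma true_at_Top:
  fixes h :: "nat \<Rightarrow> 'v leaf \<Rightarrow> 'w leaf"
  defines "lv \<equiv> \<lambda>\<tau> x a. leaf_true \<tau> (h (to_nat x) a)"
  shows "circuit_fun (relabel h G) \<tau> \<longleftrightarrow> true_at (relabel h G) \<tau> (to_nat (Base r)) \<or>
      (\<exists>t<T. lv \<tau> (Term t 0) (Cst True) \<and> (\<forall>i<m.
         lv \<tau> (PosLit t i) (Lit (Pos (z i))) \<and> lv \<tau> (PosGuard t i) (A t i) \<or>
         lv \<tau> (NegLit t i) (Lit (Neg (z i))) \<and> lv \<tau> (NegGuard t i) (B t i))) \<or>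
      lv \<tau> (Alt 0) (Cst False)"
proof -
  let ?v = "\<lambda>x. true_at (relabel h G) \<tau> (to_nat x)"
  note step = true_at_gate_value[of "relabel h G" \<tau>]
  have fac: "?v (Factor t i) \<longleftrightarrow> 
      lv \<tau> (PosLit t i) (Lit (Pos (z i))) \<and> lv \<tau> (PosGuard t i) (A t i) \<or>
      lv \<tau> (NegLit t i) (Lit (Neg (z i))) \<and> lv \<tau> (NegGuard t i) (B t i)" for t i
    by (simp add: step[of "to_nat (Factor t i)"] step[of "to_nat (PosArm t i)"]
        step[of "to_nat (NegArm t i)"] step[of "to_nat (PosLit t i)"] step[of "to_nat (NegLit t i)"]
        step[of "to_nat (PosGuard t i)"] step[of "to_nat (NegGuard t i)"] leaf.map_id lv_def)
  have trm: "?v (Term t k) \<longleftrightarrow> lv \<tau> (Term t 0) (Cst True) \<and> (\<forall>i<k. ?v (Factor t i))" for t k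
  proof (induction k)
    case 0
    show ?case by (simp add: step[of "to_nat (Term t 0)"] lv_def)
  next
    case (Suc k)
    then show ?case by (auto simp: step[of "to_nat (Term t (Suc k))"] less_Suc_eq)
  qed
  have alt: "?v (Alt k) \<longleftrightarrow> lv \<tau> (Alt 0) (Cst False) \<or> (\<exists>t<k. ?v (Term t m))" for k
  proof (induction k)
    case 0
    show ?case by (simp add: step[of "to_nat (Alt 0)"] lv_def)
  next
    case (Suc k)
    then show ?case by (auto simp: step[of "to_nat (Alt (Suc k))"] less_Suc_eq)
  qed
  have "circuit_fun (relabel h G) \<tau> \<longleftrightarrow> ?v (Base r) \<or> ?v (Alt T)"
    by (simp add: circuit_fun_def step[of "to_nat Top"])
  then show ?thesis
    using alt trm fac by auto
qed

text \<open>The base part reaches only base nodes, so the leaves of the terms do not affect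
  it.\<close>

lemma true_at_Base_mono:
  assumes "true_at (relabel h G) \<tau> (to_nat (Base r))"
    and "\<And>k a. to_nat (Base k) \<in> nodes G \<Longrightarrow> k \<le> r \<Longrightarrow> g k = Leaf a \<Longrightarrow>
        leaf_true \<tau> (h (to_nat (Base k)) a) \<Longrightarrow> leaf_true \<tau>' (h' (to_nat (Base k)) a)"
  shows "true_at (relabel h' G) \<tau>' (to_nat (Base r))"
  using assms(1)
proof (rule true_at_relabel_mono[where N = "nodes G \<inter> (to_nat \<circ> Base) ` {..r}"])
  show "to_nat (Base r) \<in> nodes G \<inter> (to_nat \<circ> Base) ` {..r}"
    using Base_in_nodes by auto
next
  fix y assume y: "y \<in> nodes G \<inter> (to_nat \<circ> Base) ` {..r}"
  then obtain k where k: "y = to_nat (Base k)" "k \<le> r" by auto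
  have "to_nat x \<in> nodes G" if "x \<in> children (node_gate (Base k))" for x
    using y k(1) that child_in_nodes[of "Base k" x] by auto
  then show "children (gate G y) \<subseteq> nodes G \<inter> (to_nat \<circ> Base) ` {..r}"
    using k base_children[of k] by (fastforce simp: children_map_gate)
  show "leaf_true \<tau>' (h' y a)" if "gate G y = Leaf a" "leaf_true \<tau> (h y a)" for a
    using that k y assms(2)[of k a] by (cases "g k") (auto simp: leaf.map_id)
qed

lemma true_at_Base: "k \<le> r \<Longrightarrow> true_at G \<sigma> (to_nat (Base k)) = val k \<sigma>"
proof (induction k rule: less_induct)
  case (less k)
  have "true_at G \<sigma> (to_nat (Base k)) = gate_value (\<lambda>i. true_at G \<sigma> (to_nat (Base i))) \<sigma> (g k)"
    by (subst true_at_gate_value) (cases "g k"; simp add: leaf.map_id)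
  also have "\<dots> = gate_value (\<lambda>i. val i \<sigma>) \<sigma> (g k)"
  proof (rule gate_value_cong)
    fix i assume "i \<in> children (g k)"
    then show "true_at G \<sigma> (to_nat (Base i)) = val i \<sigma>"
      using less base_children[of k] by (intro less.IH) auto
  qed
  also have "\<dots> = val k \<sigma>"
    using prog less.prems by (simp add: program_def)
  finally show ?case .
qed

lemma relabel_id: "relabel (\<lambda>x a. a) G = G"
  using set_leaves_empty[of False G] by (simp add: set_leaves_def)

text \<open>By \<open>sound\<close>, every term implies the base function, so the added disjuncts
  are absorbed.\<close>

lemma circuit_fun_G: "circuit_fun G = val r"
proof
  fix \<sigma>
  show "circuit_fun G \<sigma> = val r \<sigma>"
    using true_at_Top[of "\<lambda>x a. a" \<sigma>] sound by (auto simp: relabel_id true_at_Base)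
qed

text \<open>Output leaves inside the base program are left out and keep their labels.\<close>

definition switches :: "node set" where
  "switches = case_prod PosLit ` ({..<T} \<times> {..<m}) \<union> case_prod NegLit ` ({..<T} \<times> {..<m})"

lemma finite_switches: "finite switches"
  by (simp add: switches_def)

lemma switches_cases:
  assumes "x \<in> switches"
  obtains t i where "t < T" "i < m" "x = PosLit t i" "node_gate x = Leaf (Lit (Pos (z i)))"
    | t i where "t < T" "i < m" "x = NegLit t i" "node_gate x = Leaf (Lit (Neg (z i)))"
  using assms by (auto simp: switches_def)

text \<open>With both literals true, a factor becomes the disjunction of its guards. The base part
  is unchanged and, by \<open>complete\<close>, implies the resulting formula, hence is
  absorbed.\<close>

lemma independent_of_outputs:
  "independent_of (circuit_fun (set_leaves (to_nat ` switches) True G)) (z ` {..<m})"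
proof -
  let ?h = "\<lambda>x a. if x \<in> to_nat ` switches then Cst True else a"
  let ?\<psi> = "\<lambda>\<sigma>. \<exists>t<T. \<forall>i<m. leaf_true \<sigma> (A t i) \<or> leaf_true \<sigma> (B t i)"
  have "true_at (relabel ?h G) \<sigma> (to_nat (Base r)) \<Longrightarrow> true_at (relabel (\<lambda>x a. a) G) \<sigma> (to_nat (Base r))" for \<sigma>
    by (erule true_at_Base_mono) (auto simp: switches_def split: if_splits)
  then have "true_at (relabel ?h G) \<sigma> (to_nat (Base r)) \<Longrightarrow> ?\<psi> \<sigma>" for \<sigma>
    using complete true_at_Base[of r \<sigma>] by (simp add: relabel_id)
  moreover have "PosLit t i \<in> switches" "NegLit t i \<in> switches" if "t < T" "i < m" for t i
    using that by (auto simp: switches_def)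
  moreover have "PosGuard t i \<notin> switches" "NegGuard t i \<notin> switches" "Term t i \<notin> switches"
    "Alt t \<notin> switches" for t i
    by (auto simp: switches_def)
  ultimately have eq: "circuit_fun (set_leaves (to_nat ` switches) True G) \<sigma> \<longleftrightarrow> ?\<psi> \<sigma>" for \<sigma>
    unfolding set_leaves_def using true_at_Top[of ?h \<sigma>]
    by (auto simp: inj_image_mem_iff)
  have leaf: "leaf_true \<sigma> a = leaf_true \<tau> a"
    if "\<And>v. v \<notin> z ` {..<m} \<Longrightarrow> \<sigma> v = \<tau> v" "\<And>u. a = Lit u \<Longrightarrow> var_of u \<notin> z ` {..<m}" for \<sigma> \<tau> a
  proof (cases a)
    case (Lit u)
    then show ?thesis using that by (cases u) auto
  qed simp
  show ?thesis
    unfolding independent_of_def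
  proof (intro allI impI)
    fix \<sigma> \<tau> :: "'v \<Rightarrow> bool" assume *: "\<forall>v. v \<notin> z ` {..<m} \<longrightarrow> \<sigma> v = \<tau> v"
    have "leaf_true \<sigma> (A t i) = leaf_true \<tau> (A t i)" "leaf_true \<sigma> (B t i) = leaf_true \<tau> (B t i)"
      if "t < T" "i < m" for t i
      using * guard[OF that] by (auto intro!: leaf)
    then show "circuit_fun (set_leaves (to_nat ` switches) True G) \<sigma> =
        circuit_fun (set_leaves (to_nat ` switches) True G) \<tau>"
      unfolding eq by (intro ex_cong1 conj_cong refl all_cong1 imp_cong) auto
  qed
qed

text \<open>
  Suppose the circuit computes $w \wedge w'$, where the leaf \<open>x\<close> carries $w$ and lies in factor $i$
  of term $t$. The other parts of the circuit do not depend on $w$, so the truth at $(1,1)$ and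
  falsity at $(0,1)$ must come from term $t$: its other factors are true and the guard of \<open>x\<close> is
  true. Then the term is true at $(1,0)$ as well.
\<close>

lemma unrealizable:
  assumes x: "x \<in> switches" "x \<notin> P" and P: "P \<subseteq> switches"
  shows "\<not> and_realizable_set (set_leaves (to_nat ` P) True G) {to_nat x}"
proof
  let ?G1 = "set_leaves (to_nat ` P) True G"
  assume "and_realizable_set ?G1 {to_nat x}"
  then obtain u where xu: "to_nat x \<in> lit_leaves ?G1 u"
    and re: "and_realizable (set_leaves (lit_leaves ?G1 u - {to_nat x}) False ?G1) u"
    unfolding and_realizable_set_def by auto
  \<comment> \<open>The remaining leaves labelled \<open>u\<close>, which realizability of a set
    fixes to false.\<close>
  define Q where "Q = lit_leaves ?G1 u - {to_nat x}"
  \<comment> \<open>The three relabellings fused into one, so that \<open>true_at_Top\<close>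
    applies; the later one, on \<open>Q\<close>, is tested before the one on
    \<open>P\<close>.\<close>
  define h where "h = (\<lambda>y a. let b = if y \<in> Q then Cst False else if y \<in> to_nat ` P then Cst True else a in
     if b = Lit u then Lit (Pos W) else if b = Lit (compl u) then Lit (Pos W') else map_leaf Old b)"
  have H: "split_lit u (set_leaves Q False ?G1) = relabel h G"
    unfolding split_lit_def set_leaves_def relabel_relabel h_def Let_def by (rule refl)
  obtain \<sigma> where \<sigma>: "\<And>\<tau>. (\<forall>v. v \<noteq> var_of u \<longrightarrow> \<tau> (Old v) = \<sigma> v) \<Longrightarrow>
      circuit_fun (relabel h G) \<tau> = (\<tau> W \<and> \<tau> W')"
    using re unfolding and_realizable_def Q_def[symmetric] H by blast
  define \<tau> where "\<tau> = (\<lambda>b b'. case_fresh \<sigma> b b')"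
  have ev: "circuit_fun (relabel h G) (\<tau> b b') = (b \<and> b')" for b b'
    using \<sigma>[of "\<tau> b b'"] by (simp add: \<tau>_def)
  define lv where "lv = (\<lambda>b b' (y :: node) a. leaf_true (\<tau> b b') (h (to_nat y) a))"
  have x_leaf: "node_gate x = Leaf (Lit u)"
    using xu x(2) by (cases "node_gate x") (auto simp: lit_leaves_def set_leaves_def leaf.map_id inj_image_mem_iff)
  have lv_x: "lv b b' x (Lit u) = b" for b b'
    using x(2) by (simp add: lv_def h_def \<tau>_def Q_def inj_image_mem_iff)
  \<comment> \<open>Only \<open>x\<close> depends on \<open>w\<close>: every other leaf with literal
    \<open>u\<close> is true by \<open>P\<close> or false by \<open>Q\<close>. This includes the
    leaves of the base program.\<close>
  have lv_W: "lv b b' y a = lv c b' y a"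
    if "to_nat y \<in> nodes G" "node_gate y = Leaf a" "y \<noteq> x" for b b' c y a
  proof (cases "a = Lit u \<and> y \<notin> P")
    case True
    then have "to_nat y \<in> Q"
      using that by (auto simp: Q_def lit_leaves_def set_leaves_def lit.map_id inj_image_mem_iff)
    then show ?thesis by (simp add: lv_def h_def)
  next
    case False
    then show ?thesis
      by (cases a) (auto simp: lv_def h_def \<tau>_def inj_image_mem_iff Let_def lit_true_Old)
  qed
  have lv_Old: "lv b b' y a = lv c c' y a" if "\<And>w. a = Lit w \<Longrightarrow> var_of w \<noteq> var_of u" for b b' c c' y a
    using that var_of_compl[of u] 
    by (cases a) (auto simp: lv_def h_def \<tau>_def Let_def lit_true_Old)
  obtain t i where ti: "t < T" "i < m" and u: "var_of u = z i"
    and x_cases: "x = PosLit t i \<and> u = Pos (z i) \<or> x = NegLit t i \<and> u = Neg (z i)"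
    using x(1) x_leaf by (auto elim!: switches_cases)
  have guards: "lv b b' y (A t i) = lv c c' y (A t i)" "lv b b' y (B t i) = lv c c' y (B t i)"
    if "t < T" "i < m" for b b' c c' y t i
  proof -
    have "var_of w \<noteq> var_of u" if "A t i = Lit w \<or> B t i = Lit w" for w
      using guard[OF \<open>t < T\<close> \<open>i < m\<close> that] ti u by auto
    then show "lv b b' y (A t i) = lv c c' y (A t i)" "lv b b' y (B t i) = lv c c' y (B t i)"
      by (auto intro!: lv_Old)
  qed
  define fac where "fac = (\<lambda>b b' t i.
      lv b b' (PosLit t i) (Lit (Pos (z i))) \<and> lv b b' (PosGuard t i) (A t i) \<or>
      lv b b' (NegLit t i) (Lit (Neg (z i))) \<and> lv b b' (NegGuard t i) (B t i))"
  have top: "b \<and> b' \<longleftrightarrow> true_at (relabel h G) (\<tau> b b') (to_nat (Base r)) \<or>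
      (\<exists>t<T. lv True True (Term t 0) (Cst True) \<and> (\<forall>i<m. fac b b' t i)) \<or>
      lv True True (Alt 0) (Cst False)" for b b'
    using true_at_Top[of h "\<tau> b b'"] lv_Old[of "Cst False" True True "Alt 0" b b']
      lv_Old[of "Cst True" True True _ b b']
    unfolding ev fac_def lv_def by auto
  have "true_at (relabel h G) (\<tau> False True) (to_nat (Base r))"
    if "true_at (relabel h G) (\<tau> True True) (to_nat (Base r))"
    using that
  proof (rule true_at_Base_mono)
    fix k a assume "to_nat (Base k) \<in> nodes G" "g k = Leaf a"
      "leaf_true (\<tau> True True) (h (to_nat (Base k)) a)"
    with lv_W[of "Base k" a True True False] x_cases
    show "leaf_true (\<tau> False True) (h (to_nat (Base k)) a)"
      by (auto simp: leaf.map_id lv_def)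
  qed
  \<comment> \<open>Truth at (1,1) cannot come from the base part or from the constant in
    \<open>Alt 0\<close>, as either would persist at (0,1).\<close>
  then obtain t' where t': "t' < T" "lv True True (Term t' 0) (Cst True)" "\<forall>i<m. fac True True t' i"
    using top[of True True] top[of False True] by blast
  then obtain i' where i': "i' < m" "\<not> fac False True t' i'"
    using top[of False True] by blast
  \<comment> \<open>The factor that fails at (0,1) must contain \<open>x\<close>, the only leaf
    sensitive to \<open>w\<close>.\<close>
  have "fac True True t' i' = fac False True t' i'" if "(t', i') \<noteq> (t, i)"
  proof -
    have "PosLit t' i' \<noteq> x" "NegLit t' i' \<noteq> x"
      using that x_cases by auto
    then have "lv True True (PosLit t' i') (Lit (Pos (z i'))) = lv False True (PosLit t' i') (Lit (Pos (z i')))"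
      "lv True True (NegLit t' i') (Lit (Neg (z i'))) = lv False True (NegLit t' i') (Lit (Neg (z i')))"
      using t'(1) i'(1) literal_in_nodes by (intro lv_W; simp)+
    then show ?thesis
      unfolding fac_def using guards[OF t'(1) i'(1), of True True _ False True] by simp
  qed
  then have eq: "t' = t" "i' = i" using t' i' by auto
  \<comment> \<open>At (1,1) the true arm is that of \<open>x\<close>, since the other one would
    persist at (0,1). So the guard of \<open>x\<close> is true, and \<open>x\<close> stays true at
    (1,0).\<close>
  have "fac True False t i"
  proof -
    have "lv True True (NegLit t i) (Lit (Neg (z i))) = lv False True (NegLit t i) (Lit (Neg (z i)))"
      if "x = PosLit t i"
      using that literal_in_nodes[OF ti] by (intro lv_W) auto
    moreover have "lv True True (PosLit t i) (Lit (Pos (z i))) = lv False True (PosLit t i) (Lit (Pos (z i)))"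
      if "x = NegLit t i"
      using that literal_in_nodes[OF ti] by (intro lv_W) auto
    moreover have "fac True True t i" "\<not> fac False True t i"
      using t' i' eq by auto
    ultimately show ?thesis
      using x_cases guards[OF ti, of True True _ False True] guards[OF ti, of True True _ True False]
        lv_x[of True False]
      unfolding fac_def by auto
  qed
  \<comment> \<open>The other factors of the term concern other variables and hence do not see
    \<open>w'\<close> either.\<close>
  moreover have "fac True False t k" if "k < m" "k \<noteq> i" for k
  proof -
    have "z k \<noteq> z i" using that ti z(1) by (auto simp: inj_on_def)
    then have "fac True False t k = fac True True t k"
      using u guards[OF ti(1) that(1), of True True _ True False]
        lv_Old[of "Lit (Pos (z k))" True True _ True False]
        lv_Old[of "Lit (Neg (z k))" True True _ True False]
      unfolding fac_def by simp
    then show ?thesis using t' eq that by simp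
  qed
  ultimately show False
    using top[of True False] t' eq by auto
qed

lemma saunf_G: "\<exists>S. saunf G (z ` {..<m}) S"
proof -
  \<comment> \<open>Any enumeration serves, because \<open>unrealizable\<close> allows an arbitrary
    set \<open>P\<close> of earlier switches.\<close>
  obtain xs where xs: "set xs = switches" "distinct xs"
    using finite_distinct_list[OF finite_switches] by blast
  have take: "x \<notin> set (take k xs)" "set (take k xs) \<subseteq> switches" if "k < length xs" "x = xs ! k" for k x
    using that xs by (auto simp: in_set_conv_nth nth_eq_iff_index_eq dest: in_set_takeD)
  let ?S = "map (\<lambda>x. {to_nat x}) xs"
  have un: "\<Union> (set (take k ?S)) = to_nat ` set (take k xs)" for k
    by (auto simp: take_map)
  have un_all: "\<Union> (set ?S) = to_nat ` switches"
    using xs(1) by auto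
  have "PosLit 0 0 \<in> switches"
    using pos by (auto simp: switches_def)
  then have "?S \<noteq> []" using xs by auto
  moreover have "\<exists>u. var_of u \<in> z ` {..<m} \<and> {to_nat x} \<subseteq> lit_leaves G u" if "x \<in> switches" for x
    using that
  proof (cases rule: switches_cases)
    case (1 t i)
    then show ?thesis
      using literal_in_nodes by (intro exI[of _ "Pos (z i)"]) (auto simp: lit_leaves_def)
  next
    case (2 t i)
    then show ?thesis
      using literal_in_nodes by (intro exI[of _ "Neg (z i)"]) (auto simp: lit_leaves_def)
  qed
  moreover have "\<not> and_realizable_set (set_leaves (\<Union> (set (take k ?S))) True G) (?S ! k)"
    if "k < length ?S" for k
    unfolding un using that unrealizable[of "xs ! k" "set (take k xs)"] take[of k] xs(1) nth_mem[of k xs]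
    by simp
  moreover have "?S ! i \<inter> ?S ! k = {}" if "i < length ?S" "k < length ?S" "i \<noteq> k" for i k
    using that xs(2) by (simp add: nth_eq_iff_index_eq)
  ultimately have "saunf G (z ` {..<m}) ?S"
    unfolding saunf_def un_all using nnf_circuit_G independent_of_outputs xs(1) by auto
  then show ?thesis ..
qed

end


section \<open>Bits of products\<close>

text \<open>The program is cut right after a gate \<open>r\<close> that computes \<phi>; as
  \<open>r < N\<close>, the size bound \<open>r + 3\<close> becomes \<open>N + 2\<close>.\<close>

lemma saunf_of_terms:
  fixes \<phi> :: "('v \<Rightarrow> bool) \<Rightarrow> bool" and z :: "nat \<Rightarrow> 'v" and A B :: "nat \<Rightarrow> nat \<Rightarrow> 'v leaf"
  assumes "computed V N {\<phi>}" "0 < T" "0 < m" "inj_on z {..<m}" "z ` {..<m} \<subseteq> V"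
    and "\<And>t i u. t < T \<Longrightarrow> i < m \<Longrightarrow> A t i = Lit u \<or> B t i = Lit u \<Longrightarrow> var_of u \<in> V - z ` {..<m}"
    and "\<And>t \<sigma>. t < T \<Longrightarrow>
      (\<And>i. i < m \<Longrightarrow> \<sigma> (z i) \<and> leaf_true \<sigma> (A t i) \<or> \<not> \<sigma> (z i) \<and> leaf_true \<sigma> (B t i)) \<Longrightarrow> \<phi> \<sigma>"
    and "\<And>\<sigma>. \<phi> \<sigma> \<Longrightarrow> \<exists>t<T. \<forall>i<m. leaf_true \<sigma> (A t i) \<or> leaf_true \<sigma> (B t i)"
  shows "\<exists>(G :: (nat, 'v) circuit) S. nnf_circuit G \<and> circuit_vars G \<subseteq> V \<and> circuit_fun G = \<phi> \<and>
    circuit_size G \<le> N + 2 + T * (8 * m + 2) \<and> saunf G (z ` {..<m}) S"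
proof -
  obtain M g val r where M: "M \<le> N" "program V M g val" "r < M" "\<phi> = val r"
    using assms(1) unfolding computed_def by auto
  interpret guarded_terms V g val r T m z A B
  proof unfold_locales
    show "program V (Suc r) g val"
      using M by (auto intro: program_le)
  qed (use assms M in \<open>auto\<close>)
  show ?thesis
    using nnf_circuit_G circuit_vars_G circuit_fun_G circuit_size_G saunf_G M by (intro exI[of _ G]) auto
qed

section \<open>Binary digits of predecessors and products\<close>

lemma bit_append_nat:
  fixes q r :: nat
  assumes "r < 2 ^ m"
  shows "bit (2 ^ m * q + r) i \<longleftrightarrow> (if i < m then bit r i else bit q (i - m))"
proof (cases "i < m")
  case True
  have "take_bit m (2 ^ m * q + r) = r"
    using assms by (simp add: take_bit_eq_mod)
  with True show ?thesis
    by (metis bit_take_bit_iff)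
next
  case False
  have "drop_bit m (2 ^ m * q + r) = q"
    using assms by (simp add: drop_bit_eq_div)
  with False show ?thesis
    by (metis bit_drop_bit_eq comp_apply le_add_diff_inverse not_less)
qed

text \<open>Borrowing clears the lowest one and sets all bits below it:
  \<open>2 ^ Suc t * q + 2 ^ t\<close> becomes \<open>2 ^ Suc t * q + mask t\<close>.\<close>

lemma bit_pred_nat:
  fixes y :: nat
  assumes t: "bit y t" "\<And>i. i < t \<Longrightarrow> \<not> bit y i"
  shows "bit (y - 1) i \<longleftrightarrow> i < t \<or> t < i \<and> bit y i"
proof -
  define q where "q = drop_bit (Suc t) y"
  have low: "take_bit (Suc t) y = 2 ^ t"
    using t by (intro bit_eqI) (auto simp: bit_take_bit_iff bit_exp_iff less_Suc_eq)
  have y: "y = 2 ^ Suc t * q + 2 ^ t"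
    using bits_ident[of "Suc t" y] low by (simp add: q_def push_bit_eq_mult mult.commute)
  have "y - 1 = 2 ^ Suc t * q + mask t"
    unfolding y mask_eq_exp_minus_1 by simp
  moreover have "(mask t :: nat) < 2 ^ Suc t"
    by (simp add: mask_eq_exp_minus_1 less_imp_diff_less)
  ultimately have "bit (y - 1) i \<longleftrightarrow> (if i < Suc t then bit (mask t :: nat) i else bit q (i - Suc t))"
    using bit_append_nat by metis
  also have "bit q (i - Suc t) \<longleftrightarrow> bit y i" if "Suc t \<le> i"
    using that by (simp add: q_def bit_drop_bit_eq)
  then have "(if i < Suc t then bit (mask t :: nat) i else bit q (i - Suc t)) \<longleftrightarrow>
      i < t \<or> t < i \<and> bit y i"
    by (auto simp: bit_mask_iff)
  finally show ?thesis .
qed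

text \<open>\<open>(2 ^ n - 1) * y = 2 ^ n * (y - 1) + (2 ^ n - y)\<close>, and the last summand is
  below \<open>2 ^ n\<close>.\<close>

lemma bit_mask_times_nat:
  fixes y :: nat
  assumes "0 < y" "y < 2 ^ n"
  shows "bit (mask n * y) (n + i) \<longleftrightarrow> bit (y - 1) i"
proof -
  obtain p where p: "y = Suc p"
    using assms(1) gr0_conv_Suc by blast
  have "mask n * y = 2 ^ n * p + (2 ^ n - y)"
    using assms(2) unfolding mask_eq_exp_minus_1 p by (simp add: diff_mult_distrib algebra_simps)
  moreover have "2 ^ n - y < (2 ^ n :: nat)"
    using assms by simp
  ultimately show ?thesis
    using bit_append_nat[of "2 ^ n - y" n p "n + i"] p by simp
qed

text \<open>If the upper half were all ones, the product would be at least
  \<open>2 ^ n * mask n\<close>, but it is at most \<open>mask n * mask n\<close>.\<close>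

lemma high_bit_clear:
  fixes x y :: nat
  assumes "0 < n" "x < 2 ^ n" "y < 2 ^ n"
  shows "\<exists>i<n. \<not> bit (x * y) (n + i)"
proof (rule ccontr)
  assume "\<not> ?thesis"
  then have "take_bit n (drop_bit n (x * y)) = mask n"
    by (intro bit_eqI) (auto simp: bit_take_bit_iff bit_drop_bit_eq bit_mask_iff)
  then have "mask n \<le> x * y div 2 ^ n"
    by (metis drop_bit_eq_div take_bit_nat_less_eq_self)
  then have "2 ^ n * mask n \<le> x * y"
    by (metis le_trans mult_le_mono2 times_div_less_eq_dividend)
  also have "x * y \<le> mask n * mask n"
    using assms by (intro mult_le_mono) (auto simp: mask_eq_exp_minus_1)
  finally show False
    using assms(1) one_less_power[of "2 :: nat" n] by (auto simp: mask_eq_exp_minus_1)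
qed

section \<open>Terms for the multiplication relation\<close>

definition output_var :: "nat \<Rightarrow> nat \<Rightarrow> var" where
  "output_var n i = (if i < n then Xv (Suc i) else Yv (Suc (i - n)))"

lemma inj_output_var: "inj_on (output_var n) {..<2 * n}"
  by (auto simp: inj_on_def output_var_def split: if_splits)

lemma output_var_image: "output_var n ` {..<2 * n} = out_vars n"
proof
  show "output_var n ` {..<2 * n} \<subseteq> out_vars n"
    by (auto simp: output_var_def out_vars_def)
  have "Xv i \<in> output_var n ` {..<2 * n}" "Yv i \<in> output_var n ` {..<2 * n}" if "i \<in> {1..n}" for i
  proof -
    have "Xv i = output_var n (i - 1)" "Yv i = output_var n (n + (i - 1))"
      using that by (auto simp: output_var_def)
    then show "Xv i \<in> output_var n ` {..<2 * n}" "Yv i \<in> output_var n ` {..<2 * n}"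
      using that by auto
  qed
  then show "out_vars n \<subseteq> output_var n ` {..<2 * n}"
    by (auto simp: out_vars_def)
qed

lemma all_outputs:
  "(\<forall>i<2 * n. P i) \<longleftrightarrow> (\<forall>i<n. P i) \<and> (\<forall>i<n. P (n + i))" for n :: nat
proof -
  have "P i" if "\<forall>i<n. P i" "\<forall>i<n. P (n + i)" "i < 2 * n" for i
    using that spec[OF that(2), of "i - n"] by (cases "i < n") auto
  then show ?thesis by auto
qed

text \<open>Guards are given separately for the bits of the two factors. With
  \<open>T \<le> n\<close> the size is at most \<open>80 * n ^ 2 + 2 + n * (16 * n + 2)\<close>,
  which is within the bound.\<close>

lemma saunf_mult_rel:
  fixes A\<^sub>X B\<^sub>X A\<^sub>Y B\<^sub>Y :: "nat \<Rightarrow> nat \<Rightarrow> var leaf"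
  assumes n: "1 \<le> n" "1 \<le> l" "j \<le> 2 * n" and T: "0 < T" "T \<le> n"
    and guard: "\<And>t i u. t < T \<Longrightarrow> i < n \<Longrightarrow> Lit u \<in> {A\<^sub>X t i, B\<^sub>X t i, A\<^sub>Y t i, B\<^sub>Y t i} \<Longrightarrow>
      var_of u \<in> in_vars n"
    and sound: "\<And>t \<sigma>. t < T \<Longrightarrow>
      (\<And>i. i < n \<Longrightarrow> if bit (num_of Xv n \<sigma>) i then leaf_true \<sigma> (A\<^sub>X t i) else leaf_true \<sigma> (B\<^sub>X t i)) \<Longrightarrow>
      (\<And>i. i < n \<Longrightarrow> if bit (num_of Yv n \<sigma>) i then leaf_true \<sigma> (A\<^sub>Y t i) else leaf_true \<sigma> (B\<^sub>Y t i)) \<Longrightarrow>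
      mult_rel n l j \<sigma>"
    and complete: "\<And>\<sigma>. mult_rel n l j \<sigma> \<Longrightarrow>
      \<exists>t<T. \<forall>i<n. (leaf_true \<sigma> (A\<^sub>X t i) \<or> leaf_true \<sigma> (B\<^sub>X t i)) \<and>
        (leaf_true \<sigma> (A\<^sub>Y t i) \<or> leaf_true \<sigma> (B\<^sub>Y t i))"
  shows "\<exists>(G :: (nat, var) circuit) S. nnf_circuit G \<and>
    circuit_vars G \<subseteq> out_vars n \<union> in_vars n \<and> circuit_fun G = mult_rel n l j \<and>
    circuit_size G \<le> 100 * n ^ 2 \<and> saunf G (out_vars n) S"
proof -
  let ?A = "\<lambda>t i. if i < n then A\<^sub>X t i else A\<^sub>Y t (i - n)"
  let ?B = "\<lambda>t i. if i < n then B\<^sub>X t i else B\<^sub>Y t (i - n)"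
  have disj: "in_vars n \<inter> out_vars n = {}"
    by (auto simp: in_vars_def out_vars_def)
  have "\<exists>(G :: (nat, var) circuit) S. nnf_circuit G \<and>
      circuit_vars G \<subseteq> out_vars n \<union> in_vars n \<and> circuit_fun G = mult_rel n l j \<and>
      circuit_size G \<le> 80 * n ^ 2 + 2 + T * (8 * (2 * n) + 2) \<and> saunf G (output_var n ` {..<2 * n}) S"
  proof (rule saunf_of_terms[where A = ?A and B = ?B])
    show "computed (out_vars n \<union> in_vars n) (80 * n ^ 2) {mult_rel n l j}"
      using n by (rule computed_mult_rel)
    show "var_of u \<in> out_vars n \<union> in_vars n - output_var n ` {..<2 * n}"
      if "t < T" "i < 2 * n" "?A t i = Lit u \<or> ?B t i = Lit u" for t i u
    proof -
      have "i - n < n" using that by auto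
      then show ?thesis
        unfolding output_var_image
        using that disj guard[of t i u] guard[of t "i - n" u] by (cases "i < n") auto
    qed
    show "mult_rel n l j \<sigma>"
      if t: "t < T" and *: "\<And>i. i < 2 * n \<Longrightarrow> \<sigma> (output_var n i) \<and> leaf_true \<sigma> (?A t i) \<or>
        \<not> \<sigma> (output_var n i) \<and> leaf_true \<sigma> (?B t i)" for t \<sigma>
    proof (rule sound[OF t])
      fix i assume i: "i < n"
      show "if bit (num_of Xv n \<sigma>) i then leaf_true \<sigma> (A\<^sub>X t i) else leaf_true \<sigma> (B\<^sub>X t i)"
        using *[of i] i by (auto simp: bit_num_of output_var_def)
      show "if bit (num_of Yv n \<sigma>) i then leaf_true \<sigma> (A\<^sub>Y t i) else leaf_true \<sigma> (B\<^sub>Y t i)"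
        using *[of "n + i"] i by (auto simp: bit_num_of output_var_def)
    qed
    show "\<exists>t<T. \<forall>i<2 * n. leaf_true \<sigma> (?A t i) \<or> leaf_true \<sigma> (?B t i)" if "mult_rel n l j \<sigma>" for \<sigma>
      using complete[OF that] unfolding all_outputs by auto
  qed (use n T in \<open>auto simp: inj_output_var output_var_image\<close>)
  moreover have "80 * n ^ 2 + 2 + T * (8 * (2 * n) + 2) \<le> 100 * n ^ 2"
  proof -
    have "T * (8 * (2 * n) + 2) \<le> n * (8 * (2 * n) + 2)"
      using T(2) by (rule mult_le_mono1)
    moreover have "n * (8 * (2 * n) + 2) = 16 * n ^ 2 + 2 * n" "n \<le> n ^ 2" "1 \<le> n ^ 2"
      using n(1) by (auto simp: power2_eq_square algebra_simps)
    ultimately show ?thesis by linarith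
  qed
  ultimately show ?thesis
    unfolding output_var_image by (meson le_trans)
qed

lemma saunf_mult_rel_shift:
  assumes n: "1 \<le> n" "1 \<le> l" "l \<le> j" "j \<le> 2 * n" "j - l < n" and jl: "l \<le> n \<or> j < 2 * n"
  shows "\<exists>(G :: (nat, var) circuit) S. nnf_circuit G \<and>
    circuit_vars G \<subseteq> out_vars n \<union> in_vars n \<and> circuit_fun G = mult_rel n l j \<and>
    circuit_size G \<le> 100 * n ^ 2 \<and> saunf G (out_vars n) S"
proof -
  \<comment> \<open>The minimum ensures \<open>a < n\<close>, so that \<open>2 ^ a\<close> fits into
    \<open>X\<close>; \<open>a < l\<close> and \<open>j \<le> a + n\<close> place every compared bit
    inside the shifted copy of \<open>Y\<close>.\<close>
  define a where "a = min l n - 1"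
  have a: "a < n" "a < l" "j \<le> a + n"
    using n jl by (auto simp: a_def)
  show ?thesis
  proof (rule saunf_mult_rel[where T = 1 and A\<^sub>X = "\<lambda>t i. Cst (i = a)" and B\<^sub>X = "\<lambda>t i. Cst (i \<noteq> a)" and
        A\<^sub>Y = "\<lambda>t i. Lit (Pos (Iv (Suc (a + i))))" and B\<^sub>Y = "\<lambda>t i. Lit (Neg (Iv (Suc (a + i))))"])
    show "mult_rel n l j \<sigma>"
      if X: "\<And>i. i < n \<Longrightarrow> if bit (num_of Xv n \<sigma>) i then leaf_true \<sigma> (Cst (i = a)) else leaf_true \<sigma> (Cst (i \<noteq> a))"
      and Y: "\<And>i. i < n \<Longrightarrow> if bit (num_of Yv n \<sigma>) i then leaf_true \<sigma> (Lit (Pos (Iv (Suc (a + i)))))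
        else leaf_true \<sigma> (Lit (Neg (Iv (Suc (a + i)))))" for \<sigma>
    proof -
      have "bit (num_of Xv n \<sigma>) i \<longleftrightarrow> i = a" for i
        using X[of i] a(1) by (cases "i < n") (auto simp: bit_num_of split: if_splits)
      then have x: "num_of Xv n \<sigma> = 2 ^ a"
        by (intro bit_eqI) (auto simp: bit_exp_iff)
      have y: "bit (num_of Yv n \<sigma>) i \<longleftrightarrow> \<sigma> (Iv (Suc (a + i)))" if "i < n" for i
        using Y[OF that] by (auto split: if_splits)
      have "bit (num_of Xv n \<sigma> * num_of Yv n \<sigma>) (k - 1) = bit (num_of Iv (2 * n) \<sigma>) (k - 1)"
        if k: "k \<in> {l..j}" for k
      proof -
        have k': "a \<le> k - 1" "k - 1 - a < n" "k - 1 < 2 * n" "Suc (k - 1) = k"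
          using k a n by auto
        have "num_of Xv n \<sigma> * num_of Yv n \<sigma> = push_bit a (num_of Yv n \<sigma>)"
          by (simp add: x push_bit_eq_mult)
        then have "bit (num_of Xv n \<sigma> * num_of Yv n \<sigma>) (k - 1) \<longleftrightarrow> bit (num_of Yv n \<sigma>) (k - 1 - a)"
          using k' by (simp add: bit_push_bit_iff_nat)
        with y[OF k'(2)] k' show ?thesis
          by (simp add: bit_num_of)
      qed
      then show ?thesis by (simp add: mult_rel_def)
    qed
  \<comment> \<open>Completeness is immediate: the two guards at each position are complementary, so
    every input has a solution.\<close>
  qed (use n a in \<open>auto simp: in_vars_def\<close>)
qed

lemma saunf_mult_rel_top:
  assumes n: "1 \<le> n" "n < l" "l \<le> 2 * n"
  shows "\<exists>(G :: (nat, var) circuit) S. nnf_circuit G \<and>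
    circuit_vars G \<subseteq> out_vars n \<union> in_vars n \<and> circuit_fun G = mult_rel n l (2 * n) \<and>
    circuit_size G \<le> 100 * n ^ 2 \<and> saunf G (out_vars n) S"
proof -
  \<comment> \<open>The position of bit \<open>l\<close> within the upper half, counted from
    \<open>0\<close>; positions below \<open>s\<close> are not compared.\<close>
  define s where "s = l - 1 - n"
  \<comment> \<open>Term \<open>t\<close> makes \<open>t\<close> the lowest one of \<open>Y\<close>,
    hence the lowest zero of \<open>Y - 1\<close>. Above \<open>t\<close> the guards are
    complementary literals, so only positions up to \<open>t\<close> can restrict the input.\<close>
  define A where "A = (\<lambda>t i. if i < t then Cst False
    else if i = t then (if s \<le> t then Lit (Neg (Iv (Suc (n + t)))) else Cst True)
    else Lit (Pos (Iv (Suc (n + i)))))"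
  define B where "B = (\<lambda>t i. if i < t then (if s \<le> i then Lit (Pos (Iv (Suc (n + i)))) else Cst True)
    else if i = t then Cst False
    else Lit (Neg (Iv (Suc (n + i)))))"
  show ?thesis
  proof (rule saunf_mult_rel[where T = n and A\<^sub>X = "\<lambda>t i. Cst True" and B\<^sub>X = "\<lambda>t i. Cst False" and
        A\<^sub>Y = A and B\<^sub>Y = B])
    show "var_of u \<in> in_vars n"
      if "t < n" "i < n" "Lit u \<in> {Cst True, Cst False, A t i, B t i}" for t i u
      using that by (auto simp: A_def B_def in_vars_def split: if_splits)
    show "mult_rel n l (2 * n) \<sigma>"
      if t: "t < n"
        and X: "\<And>i. i < n \<Longrightarrow> if bit (num_of Xv n \<sigma>) i then leaf_true \<sigma> (Cst True) else leaf_true \<sigma> (Cst False)"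
        and Y: "\<And>i. i < n \<Longrightarrow> if bit (num_of Yv n \<sigma>) i then leaf_true \<sigma> (A t i) else leaf_true \<sigma> (B t i)" for t \<sigma>
    proof -
      let ?y = "num_of Yv n \<sigma>"
      have "bit (num_of Xv n \<sigma>) i \<longleftrightarrow> i < n" for i
        using X[of i] by (cases "i < n") (auto simp: bit_num_of split: if_splits)
      then have x: "num_of Xv n \<sigma> = mask n"
        by (intro bit_eqI) (auto simp: bit_mask_iff)
      have yt: "bit ?y t" "\<And>i. i < t \<Longrightarrow> \<not> bit ?y i"
        using Y t by (force simp: A_def B_def split: if_splits)+
      then have pos: "0 < ?y"
        by (metis bit_0_eq bot_apply bot_bool_def gr0I)
      have "bit (num_of Xv n \<sigma> * num_of Yv n \<sigma>) (k - 1) = bit (num_of Iv (2 * n) \<sigma>) (k - 1)"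
        if k: "k \<in> {l..2 * n}" for k
      proof -
        define i where "i = k - 1 - n"
        have i: "k - 1 = n + i" "s \<le> i" "i < n"
          using k n by (auto simp: i_def s_def)
        have "bit (?y - 1) i \<longleftrightarrow> i < t \<or> t < i \<and> bit ?y i"
          by (rule bit_pred_nat[OF yt(1)]) (rule yt(2))
        then have "bit (?y - 1) i \<longleftrightarrow> \<sigma> (Iv (Suc (n + i)))"
          using Y[OF i(3)] yt(1) yt(2)[of i] i(2) unfolding A_def B_def
          by (auto split: if_splits)
        then show ?thesis
          using bit_mask_times_nat[OF pos num_of_less, of i] i by (simp add: x bit_num_of)
      qed
      then show ?thesis by (simp add: mult_rel_def)
    qed
    show "\<exists>t<n. \<forall>i<n. (leaf_true \<sigma> (Cst True) \<or> leaf_true \<sigma> (Cst False)) \<and>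
        (leaf_true \<sigma> (A t i) \<or> leaf_true \<sigma> (B t i))" if rel: "mult_rel n l (2 * n) \<sigma>" for \<sigma>
    proof (cases "s = 0")
      \<comment> \<open>Position \<open>0\<close> is not compared, so the term \<open>t = 0\<close>
        imposes nothing on the input.\<close>
      case False
      then show ?thesis
        using n by (intro exI[of _ 0]) (auto simp: A_def B_def)
    next
      \<comment> \<open>Now the whole upper half is compared. It cannot be all ones by
        \<open>high_bit_clear\<close>, so its lowest zero exists and selects the term.\<close>
      case True
      let ?P = "\<lambda>i. i < n \<and> \<not> \<sigma> (Iv (Suc (n + i)))"
      obtain i where i: "i < n" "\<not> bit (num_of Xv n \<sigma> * num_of Yv n \<sigma>) (n + i)"
        using high_bit_clear[of n "num_of Xv n \<sigma>" "num_of Yv n \<sigma>"] n by (auto simp: num_of_less)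
      moreover have "Suc (n + i) \<in> {l..2 * n}"
        using i n True by (auto simp: s_def)
      ultimately have "\<not> bit (num_of Iv (2 * n) \<sigma>) (n + i)"
        using rel unfolding mult_rel_def by fastforce
      then have "?P i" using i by (simp add: bit_num_of)
      define t where "t = (LEAST i. ?P i)"
      have "?P t"
        unfolding t_def by (rule LeastI) fact
      moreover have "\<sigma> (Iv (Suc (n + i)))" if "i < t" for i
        using not_less_Least[of i ?P] that \<open>?P t\<close> unfolding t_def[symmetric] by auto
      ultimately show ?thesis
        by (intro exI[of _ t]) (auto simp: A_def B_def)
    qed
  qed (use n in auto)
qed

theorem theorem6:
  "\<exists>p :: nat poly. \<forall>n l j :: nat.
     1 \<le> n \<longrightarrow> 1 \<le> l \<longrightarrow> l \<le> j \<longrightarrow> j \<le> 2 * n \<longrightarrow> j - l < n \<longrightarrow>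
     (\<exists>(G :: (nat, var) circuit) S.
        nnf_circuit G \<and>
        circuit_vars G \<subseteq> out_vars n \<union> in_vars n \<and>
        circuit_fun G = mult_rel n l j \<and>
        circuit_size G \<le> poly p n \<and>
        saunf G (out_vars n) S)"
proof (intro exI[of _ "monom 100 2"] allI impI)
  fix n l j :: nat
  assume n: "1 \<le> n" "1 \<le> l" "l \<le> j" "j \<le> 2 * n" "j - l < n"
  show "\<exists>(G :: (nat, var) circuit) S. nnf_circuit G \<and>
      circuit_vars G \<subseteq> out_vars n \<union> in_vars n \<and> circuit_fun G = mult_rel n l j \<and>
      circuit_size G \<le> poly (monom 100 2) n \<and> saunf G (out_vars n) S"
  proof (cases "l \<le> n \<or> j < 2 * n")
    case True
    then show ?thesis
      unfolding poly_monom using n by (intro saunf_mult_rel_shift)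
  next
    case False
    \<comment> \<open>Shifts fail here: for \<open>a < n\<close> the product
      \<open>2 ^ a * Y\<close> is below \<open>2 ^ (2 * n - 1)\<close>, so its top bit would always
      be zero.\<close>
    then have "n < l" "l \<le> 2 * n" "j = 2 * n"
      using n by auto
    with saunf_mult_rel_top[OF n(1) this(1,2)] show ?thesis
      unfolding poly_monom by simp
  qed
qed

end
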